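(* Let $g:(0,\infty)\to(0,\infty)$ be a decreasing function satisfying one of: (a) $g$ varies regularly at infinity with index strictly less than $-2$; or (b) the function $u\mapsto u^2g(u)$ is monotone and has a finite limit as $u\to\infty$. Then: (1) If $\int_0^\infty u^{-1}\Lambda_g(u)\,du<\infty$ and $\Lambda_g$ is bounded from above, then there exists a constant $c>0$ such that $\mathbb P$-a.s. for all $n$ large enough $\lambda_1^{(n)}\ge c\,g(n)$. (2) If $\int_0^\infty u^{-1}\Lambda_g(u)\,du=\infty$, then $\mathbb P$-a.s. $\liminf_{n\to\infty}\lambda_1^{(n)}/g(n)=0$.
   Context: Let $d\ge 2$, $\mathfrak E_d$ the nearest-neighbour edges of $\mathbb Z^d$, $x\sim y$ if $|x-y|_1=1$. Conductances $(w_e)_{e\in\mathfrak E_d}$ are i.i.d. $(0,\infty)$-valued with law $\mathbb P$; $w$ denotes a generic copy. $B_n=[-n,n]^d\cap\mathbb Z^d$. $\mathcal E^{\boldsymbol w}(f)=\frac12\sum_{x}\sum_{y\sim x}w_{xy}(f(x)-f(y))^2$ and $\lambda_1^{(n)}=\inf\{\mathcal E^{\boldsymbol w}(f): f\in\ell^2(\mathbb Z^d)\text{ real},\ \mathrm{supp}\,f\subseteq B_n,\ \|f\|_2=1\}$ (principal Dirichlet eigenvalue in $B_n$ of $-\mathcal L_{\boldsymbol w}$, $(\mathcal L_{\boldsymbol w}f)(x)=\sum_{y\sim x}w_{xy}(f(y)-f(x))$). $\Lambda_g(u)=u^d\,\mathbb P[w\le g(u)]^{2d}$. Regular variation at infinity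 with index $\rho$: $g(u)=u^\rho L(u)$ with $L(Cu)/L(u)\to1$ as $u\to\infty$ for all $C>0$. *)

theory Defs
  imports "HOL-Probability.Probability"
begin

definition adj :: "int ^ 'd \<Rightarrow> int ^ 'd \<Rightarrow> bool" where
  "adj x y \<longleftrightarrow> (\<Sum>i\<in>UNIV. \<bar>x $ i - y $ i\<bar>) = 1"

definition edges :: "(int ^ 'd) set set" where
  "edges = {{x, y} | x y. adj x y}"

definition box :: "nat \<Rightarrow> (int ^ 'd) set" where
  "box n = {x. \<forall>i. \<bar>x $ i\<bar> \<le> int n}"

definition energy :: "((int ^ 'd) set \<Rightarrow> real) \<Rightarrow> (int ^ 'd \<Rightarrow> real) \<Rightarrow> real" where
  "energy w f = (1/2) * (\<Sum>\<^sub>\<infinity>(x, y)\<in>{(x, y). adj x y}. w {x, y} * (f x - f y)^2)"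

definition lambda1 :: "nat \<Rightarrow> ((int ^ 'd) set \<Rightarrow> real) \<Rightarrow> real" where
  "lambda1 n w = Inf {energy w f | f :: int ^ 'd \<Rightarrow> real.
      {x. f x \<noteq> 0} \<subseteq> box n \<and> (\<Sum>\<^sub>\<infinity>x. (f x)^2) = 1}"

text \<open>Lambda_g(u) = u^d P[w <= g(u)]^(2d), where mu is the law of a single conductance.\<close>
definition Lambda :: "nat \<Rightarrow> real measure \<Rightarrow> (real \<Rightarrow> real) \<Rightarrow> real \<Rightarrow> real" where
  "Lambda d mu g u = u ^ d * (measure mu {..g u}) ^ (2 * d)"

definition regularly_varying :: "(real \<Rightarrow> real) \<Rightarrow> real \<Rightarrow> bool" where
  "regularly_varying g \<rho> \<longleftrightarrow>
     (\<forall>C>0. ((\<lambda>u. (g (C * u) / (C * u) powr \<rho>) / (g u / u powr \<rho>)) \<longlongrightarrow> 1) at_top)"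

end

theory Submission
  imports Defs
begin

text \<open>
Two neighbours \<open>x\<close> and \<open>x + e\<^sub>i\<close> of the lattice are joined by \<open>2d\<close> edge-disjoint routes of length at most 9.
Hence they are badly connected at level \<open>g m\<close> only if \<open>2d\<close> edges near \<open>x\<close> have conductance at
most \<open>g m\<close>, which has probability at most a constant times \<open>P[w \<le> g m] ^ (2 * d)\<close>. Let \<open>R x\<close> be the
smallest \<open>m\<close> for which this fails. Finiteness of the integral says that \<open>(R x) ^ d\<close> has finite mean, so
a truncated second moment argument along dyadic scales gives that almost surely all \<open>R x\<close> with \<open>x\<close>
in the box of radius \<open>n\<close> are at most \<open>n\<close> and \<open>(\<Sum>x. (R x) ^ d) \<le> C * n ^ d\<close>. Both conditions on \<open>g\<close> imply
\<open>n\<^sup>2 * g n \<le> K * r\<^sup>2 * g r\<close> for large \<open>r \<le> n\<close>, so the effective conductance between \<open>x\<close> and its neighbours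
is at least \<open>(g n / K) * (n / R x)\<^sup>2\<close>. The Gagliardo-Nirenberg-Sobolev inequality applied to
\<open>\<bar>f\<bar> powr (2 * (d - 1) / d)\<close> together with Hoelder's inequality bounds the energy below exactly in terms of
\<open>\<Sum>x. (R x / n) ^ d\<close>, which proves (1).

For (2), the same property of \<open>g\<close> makes the integral with \<open>\<epsilon> * g\<close> in place of \<open>g\<close> diverge for every \<open>\<epsilon> > 0\<close>.
By the second Borel-Cantelli lemma, infinitely many sites \<open>x\<close> of the even sublattice have
all their edges of conductance at most \<open>\<epsilon> * g n\<close>, where \<open>n\<close> is the sup-norm of \<open>x\<close>, and the indicator of
such a site is a test function of energy at most \<open>2 * d * \<epsilon> * g n\<close>.
\<close>

section \<open>Sobolev inequality on the lattice\<close>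

text \<open>Concavity of the logarithm, in the form \<open>ln z \<le> z - 1\<close> at the ratios
  \<open>a i / S\<close> to the weighted mean \<open>S\<close>. A vanishing \<open>a i\<close> makes
  the product 0, since \<open>0 powr r = 0\<close> for every \<open>r\<close>.\<close>

lemma weighted_amgm:
  fixes a \<theta> :: "'i \<Rightarrow> real"
  assumes fin: "finite I" and a: "\<And>i. i \<in> I \<Longrightarrow> 0 \<le> a i"
    and \<theta>: "\<And>i. i \<in> I \<Longrightarrow> 0 \<le> \<theta> i" and one: "(\<Sum>i\<in>I. \<theta> i) = 1"
  shows "(\<Prod>i\<in>I. a i powr \<theta> i) \<le> (\<Sum>i\<in>I. \<theta> i * a i)"
proof -
  define S where "S = (\<Sum>i\<in>I. \<theta> i * a i)"
  have S0: "S \<ge> 0" unfolding S_def by (intro sum_nonneg mult_nonneg_nonneg a \<theta>)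
  show ?thesis
  proof (cases "\<exists>i\<in>I. a i = 0")
    case True
    then have "(\<Prod>i\<in>I. a i powr \<theta> i) = 0" using fin by (auto simp: prod_zero_iff)
    then show ?thesis using S0 by (simp add: S_def)
  next
    case False
    then have pos: "a i > 0" if "i \<in> I" for i using a that by (metis less_eq_real_def)
    have "S \<noteq> 0"
    proof
      assume "S = 0"
      then have "\<forall>i\<in>I. \<theta> i * a i = 0" unfolding S_def
        by (subst (asm) sum_nonneg_eq_0_iff) (auto intro: fin mult_nonneg_nonneg a \<theta>)
      then have "\<forall>i\<in>I. \<theta> i = 0" using pos by fastforce
      then show False using one by simp
    qed
    then have Sp: "S > 0" using S0 by simp
    have "(\<Sum>i\<in>I. \<theta> i * ln (a i)) \<le> (\<Sum>i\<in>I. \<theta> i * (ln S + (a i / S - 1)))"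
    proof (intro sum_mono mult_left_mono \<theta>)
      fix i assume i: "i \<in> I"
      have "ln (a i) - ln S = ln (a i / S)" using pos[OF i] Sp by (simp add: ln_div)
      also have "\<dots> \<le> a i / S - 1" using pos[OF i] Sp by (intro ln_le_minus_one) simp
      finally show "ln (a i) \<le> ln S + (a i / S - 1)" by simp
    qed
    also have "\<dots> = ln S * (\<Sum>i\<in>I. \<theta> i) + S / S - (\<Sum>i\<in>I. \<theta> i)"
      by (subst (3) S_def) (simp add: algebra_simps sum.distrib sum_subtractf sum_distrib_left sum_divide_distrib)
    also have "\<dots> = ln S" using Sp one by simp
    finally have *: "(\<Sum>i\<in>I. \<theta> i * ln (a i)) \<le> ln S" .
    have "(\<Prod>i\<in>I. a i powr \<theta> i) = exp (\<Sum>i\<in>I. \<theta> i * ln (a i))"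
      using pos by (simp add: exp_sum fin powr_def cong: prod.cong)
        (intro prod.cong, auto dest: pos)
    also have "\<dots> \<le> S" using * Sp by (metis exp_le_cancel_iff exp_ln)
    finally show ?thesis by (simp add: S_def)
  qed
qed

text \<open>A zero exponent is admissible: \<open>0 powr 0 = 0\<close>, consistently on both sides.\<close>

lemma Holder_sum_prod:
  fixes F :: "'i \<Rightarrow> 'x \<Rightarrow> real"
  assumes fin: "finite I" "finite X" and F: "\<And>i x. i \<in> I \<Longrightarrow> x \<in> X \<Longrightarrow> 0 \<le> F i x"
    and \<theta>: "\<And>i. i \<in> I \<Longrightarrow> 0 \<le> \<theta> i" and one: "(\<Sum>i\<in>I. \<theta> i) = 1"
  shows "(\<Sum>x\<in>X. \<Prod>i\<in>I. F i x powr \<theta> i) \<le> (\<Prod>i\<in>I. (\<Sum>x\<in>X. F i x) powr \<theta> i)"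
proof (cases "\<exists>i\<in>I. (\<Sum>x\<in>X. F i x) = 0")
  case True
  then obtain i where i: "i \<in> I" "(\<Sum>x\<in>X. F i x) = 0" by blast
  then have "\<forall>x\<in>X. F i x = 0" using sum_nonneg_eq_0_iff[of X "F i"] fin F by simp
  then have "(\<Prod>i\<in>I. F i x powr \<theta> i) = 0" if "x \<in> X" for x
    using that fin i(1) by (auto simp: prod_zero_iff)
  then have "(\<Sum>x\<in>X. \<Prod>i\<in>I. F i x powr \<theta> i) = 0" by simp
  then show ?thesis by (simp add: prod_nonneg)
next
  case False
  define S where "S i = (\<Sum>x\<in>X. F i x)" for i
  have S: "S i > 0" if "i \<in> I" for i
    using False that F by (metis S_def less_eq_real_def sum_nonneg)
  \<comment> \<open>With every \<open>F i\<close> normalised to total mass 1, pointwise AM-GM sums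
    up to the total of the weights, which is 1.\<close>
  have "(\<Sum>x\<in>X. \<Prod>i\<in>I. (F i x / S i) powr \<theta> i) \<le> (\<Sum>x\<in>X. \<Sum>i\<in>I. \<theta> i * (F i x / S i))"
    by (intro sum_mono weighted_amgm fin one \<theta>) (use F S in \<open>auto intro!: divide_nonneg_pos\<close>)
  also have "\<dots> = (\<Sum>i\<in>I. \<theta> i * (sum (F i) X / S i))"
    by (subst sum.swap) (simp add: sum_divide_distrib sum_distrib_left)
  also have "\<dots> = (\<Sum>i\<in>I. \<theta> i)" using S by (intro sum.cong) (fastforce simp: S_def)+
  also have "\<dots> = 1" by (fact one)
  finally have *: "(\<Sum>x\<in>X. \<Prod>i\<in>I. (F i x / S i) powr \<theta> i) \<le> 1" .
  have "(\<Sum>x\<in>X. \<Prod>i\<in>I. (F i x / S i) powr \<theta> i)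
      = (\<Sum>x\<in>X. \<Prod>i\<in>I. F i x powr \<theta> i) / (\<Prod>i\<in>I. S i powr \<theta> i)"
    using F S by (simp add: powr_divide prod_dividef less_imp_le sum_divide_distrib cong: sum.cong prod.cong)
  moreover have "(\<Prod>i\<in>I. S i powr \<theta> i) > 0" using S by (intro prod_pos) fastforce
  ultimately show ?thesis using * by (simp add: S_def divide_le_eq)
qed

section \<open>Sums over coordinate slabs and the Loomis-Whitney inequality\<close>

definition upd :: "'a ^ 'd \<Rightarrow> 'd \<Rightarrow> 'a \<Rightarrow> 'a ^ 'd" where
  "upd x j t = (\<chi> i. if i = j then t else x $ i)"

lemma upd_nth [simp]: "upd x j t $ i = (if i = j then t else x $ i)"
  by (simp add: upd_def)

text \<open>Freezing the coordinates outside \<open>J\<close> at their values in \<open>x\<close>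
  permits an induction on the set of summed coordinates.\<close>

definition slab :: "'a set \<Rightarrow> 'd set \<Rightarrow> 'a ^ 'd \<Rightarrow> ('a ^ 'd) set" where
  "slab T J x = {y. (\<forall>i\<in>J. y $ i \<in> T) \<and> (\<forall>i. i \<notin> J \<longrightarrow> y $ i = x $ i)}"

lemma card_vec_prod:
  fixes A :: "'d::finite \<Rightarrow> 'a set"
  shows "card {x :: 'a ^ 'd. \<forall>i. x $ i \<in> A i} = (\<Prod>i\<in>UNIV. card (A i))"
    and "(\<And>i. finite (A i)) \<Longrightarrow> finite {x :: 'a ^ 'd. \<forall>i. x $ i \<in> A i}"
proof -
  have bij: "bij_betw vec_lambda (PiE UNIV A) {x :: 'a ^ 'd. \<forall>i. x $ i \<in> A i}"
    by (rule bij_betwI[where g = vec_nth]) (auto simp: PiE_iff)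
  show "card {x :: 'a ^ 'd. \<forall>i. x $ i \<in> A i} = (\<Prod>i\<in>UNIV. card (A i))"
    using bij_betw_same_card[OF bij] by (simp add: card_PiE)
  show "finite {x :: 'a ^ 'd. \<forall>i. x $ i \<in> A i}" if "\<And>i. finite (A i)"
    using bij_betw_finite[OF bij] finite_PiE[of UNIV A] that by simp
qed

lemma slab_empty: "slab T {} x = {x}"
  by (auto simp: slab_def vec_eq_iff)

lemma finite_slab: "finite T \<Longrightarrow> finite (slab T J (x :: 'a ^ 'd::finite))"
  by (rule finite_subset[OF _ card_vec_prod(2)[of "\<lambda>i. if i \<in> J then T else {x $ i}"]])
    (auto simp: slab_def)

text \<open>Fubini in one coordinate: the larger slab is the disjoint union over \<open>t\<close> of
  the slabs whose \<open>j\<close>-th coordinate is frozen at \<open>t\<close>.\<close>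

lemma sum_slab_insert:
  fixes F :: "'a ^ 'd::finite \<Rightarrow> real"
  assumes "finite T" "j \<notin> J"
  shows "(\<Sum>y\<in>slab T (insert j J) x. F y) = (\<Sum>t\<in>T. \<Sum>y\<in>slab T J (upd x j t). F y)"
proof -
  have eq: "slab T (insert j J) x = (\<Union>t\<in>T. slab T J (upd x j t))"
  proof (intro equalityI subsetI)
    fix y assume "y \<in> slab T (insert j J) x"
    then show "y \<in> (\<Union>t\<in>T. slab T J (upd x j t))"
      using assms(2) by (intro UN_I[of "y $ j"]) (auto simp: slab_def)
  next
    fix y assume "y \<in> (\<Union>t\<in>T. slab T J (upd x j t))"
    then show "y \<in> slab T (insert j J) x" using assms(2) by (auto simp: slab_def split: if_splits)
  qed
  show ?thesis unfolding eq
  proof (rule sum.UNION_disjoint)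
    show "\<forall>s\<in>T. \<forall>t\<in>T. s \<noteq> t \<longrightarrow> slab T J (upd x j s) \<inter> slab T J (upd x j t) = {}"
      using assms(2) by (auto simp: slab_def)
  qed (use assms finite_slab in auto)
qed

text \<open>Summing over one more coordinate \<open>j\<close> leaves the \<open>j\<close>-th factor unchanged, and the remaining \<open>d - 1\<close> factors
are handled by Hoelder with equal exponents.\<close>

lemma Loomis_Whitney_slab:
  fixes F :: "'d::finite \<Rightarrow> 'a ^ 'd \<Rightarrow> real"
  assumes T: "finite T" and d: "CARD('d) \<ge> 2"
    and F: "\<And>i x. 0 \<le> F i x" and inv: "\<And>i x t. F i (upd x i t) = F i x"
  shows "(\<Sum>y\<in>slab T J x. \<Prod>i\<in>UNIV. F i y powr (1 / (CARD('d) - 1)))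
    \<le> (\<Prod>i\<in>UNIV. (\<Sum>y\<in>slab T (J - {i}) x. F i y) powr (1 / (CARD('d) - 1)))"
proof -
  define \<theta> :: real where "\<theta> = 1 / (CARD('d) - 1)"
  have "(\<Sum>y\<in>slab T J x. \<Prod>i\<in>UNIV. F i y powr \<theta>)
    \<le> (\<Prod>i\<in>UNIV. (\<Sum>y\<in>slab T (J - {i}) x. F i y) powr \<theta>)"
    using finite[of J]
  proof (induction J arbitrary: x rule: finite_induct)
    case empty
    then show ?case by (simp add: slab_empty)
  next
    case (insert j J)
    define G where "G i x = (\<Sum>y\<in>slab T (J - {i}) x. F i y)" for i x
    have G0: "G i x \<ge> 0" for i x unfolding G_def by (intro sum_nonneg F)
    \<comment> \<open>Moving the base point in direction \<open>j\<close> maps one slab bijectively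
      onto another. Since \<open>F j\<close> does not see that coordinate, \<open>G j\<close> is
      constant in it and can be pulled out of the sum over \<open>t\<close>.\<close>
    have shift: "slab T J (upd x j t) = (\<lambda>y. upd y j t) ` slab T J x" for t
    proof (intro equalityI subsetI)
      fix y assume y: "y \<in> slab T J (upd x j t)"
      then have "y = upd (upd y j (x $ j)) j t" "upd y j (x $ j) \<in> slab T J x"
        using insert.hyps(2) by (auto simp: slab_def vec_eq_iff split: if_splits)
      then show "y \<in> (\<lambda>y. upd y j t) ` slab T J x" by blast
    qed (use insert.hyps(2) in \<open>auto simp: slab_def\<close>)
    have Gj: "G j (upd x j t) = G j x" for t
    proof -
      have "inj_on (\<lambda>y. upd y j t) (slab T J x)"
      proof (rule inj_onI)
        fix y z assume yz: "y \<in> slab T J x" "z \<in> slab T J x" "upd y j t = upd z j t"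
        have "y $ i = z $ i" for i
        proof (cases "i = j")
          case True
          then show ?thesis using yz(1,2) insert.hyps(2) by (simp add: slab_def)
        next
          case False
          then show ?thesis using arg_cong[OF yz(3), of "\<lambda>v. v $ i"] by simp
        qed
        then show "y = z" by (simp add: vec_eq_iff)
      qed
      then show ?thesis unfolding G_def using insert.hyps(2)
        by (simp add: shift sum.reindex inv)
    qed
    have "(\<Sum>y\<in>slab T (insert j J) x. \<Prod>i\<in>UNIV. F i y powr \<theta>)
      = (\<Sum>t\<in>T. \<Sum>y\<in>slab T J (upd x j t). \<Prod>i\<in>UNIV. F i y powr \<theta>)"
      using insert.hyps T by (intro sum_slab_insert) auto
    also have "\<dots> \<le> (\<Sum>t\<in>T. \<Prod>i\<in>UNIV. G i (upd x j t) powr \<theta>)"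
      unfolding G_def by (intro sum_mono insert.IH)
    also have "\<dots> = (\<Sum>t\<in>T. G j x powr \<theta> * (\<Prod>i\<in>UNIV - {j}. G i (upd x j t) powr \<theta>))"
      by (subst prod.remove[of UNIV j]) (auto simp: Gj)
    also have "\<dots> = G j x powr \<theta> * (\<Sum>t\<in>T. \<Prod>i\<in>UNIV - {j}. G i (upd x j t) powr \<theta>)"
      by (simp add: sum_distrib_left)
    also have "\<dots> \<le> G j x powr \<theta> * (\<Prod>i\<in>UNIV - {j}. (\<Sum>t\<in>T. G i (upd x j t)) powr \<theta>)"
      by (intro mult_left_mono Holder_sum_prod T G0)
        (use d in \<open>auto simp: \<theta>_def card_Diff_singleton of_nat_diff\<close>)
    also have "\<dots> = G j x powr \<theta> * (\<Prod>i\<in>UNIV - {j}. (\<Sum>y\<in>slab T (insert j J - {i}) x. F i y) powr \<theta>)"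
    proof (intro arg_cong2[where f = "(*)"] refl prod.cong)
      fix i assume i: "i \<in> UNIV - {j}"
      then have "insert j J - {i} = insert j (J - {i})" by auto
      then show "(\<Sum>t\<in>T. G i (upd x j t)) powr \<theta> = (\<Sum>y\<in>slab T (insert j J - {i}) x. F i y) powr \<theta>"
        using insert.hyps(2) T by (simp add: G_def sum_slab_insert)
    qed
    also have "\<dots> = (\<Prod>i\<in>UNIV. (\<Sum>y\<in>slab T (insert j J - {i}) x. F i y) powr \<theta>)"
      using insert.hyps(2) by (subst prod.remove[of UNIV j]) (auto simp: G_def)
    finally show ?case .
  qed
  then show ?thesis by (simp add: \<theta>_def)
qed

text \<open>A mean value bound without calculus: \<open>b / a \<le> 1\<close> and
  \<open>\<gamma> - 1 \<le> 1\<close> give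
  \<open>b powr \<gamma> \<ge> a powr (\<gamma> - 1) * b\<^sup>2 / a\<close>, and
  \<open>a - b\<^sup>2 / a \<le> 2 * (a - b)\<close> is \<open>(a - b)\<^sup>2 \<ge> 0\<close> in
  disguise.\<close>

lemma powr_diff_le:
  fixes a b :: real
  assumes "0 \<le> b" "b \<le> a" "1 \<le> \<gamma>" "\<gamma> \<le> 2"
  shows "a powr \<gamma> - b powr \<gamma> \<le> 2 * a powr (\<gamma> - 1) * (a - b)"
proof (cases "b = 0")
  case True
  then show ?thesis using assms by (cases "a = 0") (auto simp: powr_diff)
next
  case False
  then have ab: "0 < b" "0 < a" using assms by auto
  have "(b / a) powr 1 \<le> (b / a) powr (\<gamma> - 1)"
    using ab assms by (intro powr_mono') auto
  then have "a powr (\<gamma> - 1) * (b / a) \<le> b powr (\<gamma> - 1)"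
    using ab by (simp add: powr_divide field_simps)
  then have "a powr (\<gamma> - 1) * (b / a) * b \<le> b powr (\<gamma> - 1) * b"
    using ab by (intro mult_right_mono) auto
  also have "b powr (\<gamma> - 1) * b = b powr \<gamma>" using ab by (simp add: powr_diff)
  finally have 1: "a powr (\<gamma> - 1) * (b / a) * b \<le> b powr \<gamma>" .
  have 2: "a powr \<gamma> = a powr (\<gamma> - 1) * a" using ab by (simp add: powr_diff)
  have "a - b / a * b \<le> 2 * (a - b)"
    using ab sum_squares_ge_zero[of "a - b" 0] by (simp add: field_simps power2_eq_square)
  then have "a powr (\<gamma> - 1) * (a - b / a * b) \<le> a powr (\<gamma> - 1) * (2 * (a - b))"
    by (intro mult_left_mono) auto
  with 1 2 show ?thesis by (simp add: algebra_simps)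
qed

section \<open>Gagliardo-Nirenberg and weighted Poincare inequalities for finitely supported
  functions\<close>

abbreviation basis :: "'d \<Rightarrow> int ^ 'd" where
  "basis i \<equiv> axis i 1"

lemma box_eq: "box n = {x :: int ^ 'd::finite. \<forall>i. x $ i \<in> {-int n..int n}}"
  by (auto simp: box_def abs_le_iff) (metis add.inverse_inverse neg_le_iff_le)+

lemma finite_box [simp]: "finite (box n :: (int ^ 'd::finite) set)"
  unfolding box_eq by (intro card_vec_prod(2)) auto

lemma card_box: "card (box n :: (int ^ 'd::finite) set) = (2 * n + 1) ^ CARD('d)"
  unfolding box_eq by (subst card_vec_prod(1)) (simp add: nat_add_distrib nat_mult_distrib)

lemma box_mono: "m \<le> n \<Longrightarrow> box m \<subseteq> box n"
  unfolding box_def by (auto intro: order_trans)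

lemma telescope_abs_le:
  fixes v :: "int \<Rightarrow> real"
  assumes "a \<le> b" "v a = 0"
  shows "\<bar>v b\<bar> \<le> (\<Sum>t\<in>{a..<b}. \<bar>v (t + 1) - v t\<bar>)"
  using assms(1)
proof (induction b rule: int_ge_induct)
  case base
  then show ?case using assms(2) by simp
next
  case (step b)
  have "{a..<b + 1} = insert b {a..<b}" using step.hyps by auto
  then show ?case using step.IH by simp
qed

text \<open>Telescoping from outside the support bounds \<open>u x\<close> by its total variation
  \<open>F i x\<close> along the line through \<open>x\<close> in each direction \<open>i\<close>.
  Since \<open>F i\<close> does not depend on the \<open>i\<close>-th coordinate, Loomis-Whitney
  applies to the product of the \<open>F i\<close>.\<close>

lemma Gagliardo_Nirenberg_lattice:
  fixes u :: "int ^ 'd::finite \<Rightarrow> real"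
  assumes d: "CARD('d) \<ge> 2" and supp: "{x. u x \<noteq> 0} \<subseteq> box n" and u0: "\<And>x. 0 \<le> u x"
  shows "(\<Sum>x\<in>box n. u x powr (CARD('d) / (CARD('d) - 1)))
    \<le> (\<Sum>x\<in>box (Suc n). \<Sum>i\<in>UNIV. \<bar>u (x + basis i) - u x\<bar>) powr (CARD('d) / (CARD('d) - 1))"
proof -
  define d where "d = CARD('d)"
  define \<theta> :: real where "\<theta> = 1 / (d - 1)"
  \<comment> \<open>One layer beyond the support, so that telescoping starts at a zero of
    \<open>u\<close>.\<close>
  define T :: "int set" where "T = {-int (Suc n)..int (Suc n)}"
  define Du where "Du i x = \<bar>u (x + basis i) - u x\<bar>" for i x
  define F where "F i x = (\<Sum>t\<in>T. Du i (upd x i t))" for i x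
  define D where "D = (\<Sum>x\<in>box (Suc n). \<Sum>i\<in>UNIV. Du i x)"
  have slab_UNIV: "slab T UNIV x = box (Suc n)" for x
    by (auto simp: slab_def T_def box_eq)
  have F0: "F i x \<ge> 0" for i x unfolding F_def Du_def by (intro sum_nonneg) auto
  have Finv: "F i (upd x i t) = F i x" for i x t
    unfolding F_def by (intro sum.cong refl arg_cong[where f = "Du i"]) (simp add: vec_eq_iff)
  have uF: "u x \<le> F i x" if "x \<in> box n" for i x
  proof -
    define v where "v t = u (upd x i t)" for t
    have "v (- int (Suc n)) = 0"
    proof (rule ccontr)
      assume "v (- int (Suc n)) \<noteq> 0"
      then have "upd x i (- int (Suc n)) \<in> box n" using supp by (auto simp: v_def)
      then have "\<bar>upd x i (- int (Suc n)) $ i\<bar> \<le> int n" unfolding box_def by blast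
      then show False by simp
    qed
    moreover have xi: "\<bar>x $ i\<bar> \<le> int n" using that by (simp add: box_def)
    ultimately have "\<bar>v (x $ i)\<bar> \<le> (\<Sum>t\<in>{- int (Suc n)..<x $ i}. \<bar>v (t + 1) - v t\<bar>)"
      by (intro telescope_abs_le) auto
    also have "\<dots> \<le> (\<Sum>t\<in>T. \<bar>v (t + 1) - v t\<bar>)"
      by (intro sum_mono2) (use xi in \<open>auto simp: T_def\<close>)
    also have "\<dots> = F i x"
    proof -
      have "upd x i t + basis i = upd x i (t + 1)" for t by (simp add: vec_eq_iff axis_def)
      then show ?thesis by (simp add: F_def Du_def v_def)
    qed
    also have "v (x $ i) = u x" unfolding v_def by (rule arg_cong[where f = u]) (simp add: vec_eq_iff)
    finally show ?thesis by simp
  qed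
  have d2: "d \<ge> 2" using d by (simp add: d_def)
  then have \<theta>0: "\<theta> > 0" by (simp add: \<theta>_def)
  have d\<theta>: "real d * \<theta> = d / (d - 1)" by (simp add: \<theta>_def)
  have pw: "(\<Prod>i\<in>(UNIV::'d set). a powr \<theta>) = a powr (d / (d - 1))" if "a \<ge> 0" for a
  proof (cases "a = 0")
    case False
    then have "(\<Prod>i\<in>(UNIV::'d set). a powr \<theta>) = (a powr \<theta>) powr real d"
      using that by (simp add: d_def powr_realpow)
    then show ?thesis by (simp only: powr_powr d\<theta> mult.commute[of \<theta>])
  qed simp
  have "(\<Sum>x\<in>box n. u x powr (d / (d - 1))) \<le> (\<Sum>x\<in>box n. \<Prod>i\<in>UNIV. F i x powr \<theta>)"
    by (subst pw[OF u0, symmetric], intro sum_mono prod_mono conjI powr_mono2 uF) (use u0 \<theta>0 in auto)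
  also have "\<dots> \<le> (\<Sum>x\<in>slab T UNIV 0. \<Prod>i\<in>UNIV. F i x powr \<theta>)"
    unfolding slab_UNIV by (intro sum_mono2) (auto intro!: prod_nonneg box_mono)
  also have "\<dots> \<le> (\<Prod>i\<in>UNIV. (\<Sum>y\<in>slab T (UNIV - {i}) 0. F i y) powr \<theta>)"
    unfolding \<theta>_def d_def by (intro Loomis_Whitney_slab F0 Finv d) (simp add: T_def)
  also have "\<dots> \<le> (\<Prod>i\<in>(UNIV::'d set). D powr \<theta>)"
  proof (intro prod_mono conjI powr_mono2)
    fix i :: 'd
    \<comment> \<open>\<open>F i\<close> has already summed along direction \<open>i\<close>;
      summing over the other coordinates recovers the whole box.\<close>
    have "(\<Sum>y\<in>slab T (UNIV - {i}) 0. F i y) = (\<Sum>t\<in>T. \<Sum>y\<in>slab T (UNIV - {i}) 0. Du i (upd y i t))"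
      unfolding F_def by (rule sum.swap)
    also have "\<dots> = (\<Sum>t\<in>T. \<Sum>y\<in>slab T (UNIV - {i}) (upd 0 i t). Du i y)"
    proof (rule sum.cong[OF refl])
      fix t
      show "(\<Sum>y\<in>slab T (UNIV - {i}) 0. Du i (upd y i t)) = (\<Sum>y\<in>slab T (UNIV - {i}) (upd 0 i t). Du i y)"
        by (rule sum.reindex_bij_witness[where i = "\<lambda>y. upd y i 0" and j = "\<lambda>y. upd y i t"])
          (auto simp: slab_def vec_eq_iff)
    qed
    also have "\<dots> = (\<Sum>y\<in>slab T (insert i (UNIV - {i})) 0. Du i y)"
      by (rule sum_slab_insert[symmetric]) (auto simp: T_def)
    also have "\<dots> = (\<Sum>y\<in>box (Suc n). Du i y)"
      by (simp add: insert_Diff_if slab_UNIV insert_absorb)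
    also have "\<dots> \<le> D" unfolding D_def by (intro sum_mono member_le_sum) (auto simp: Du_def)
    finally show "(\<Sum>y\<in>slab T (UNIV - {i}) 0. F i y) \<le> D" .
  qed (use \<theta>0 F0 in \<open>auto intro!: sum_nonneg\<close>)
  also have "\<dots> = D powr (d / (d - 1))"
    by (rule pw) (auto simp: D_def Du_def intro!: sum_nonneg)
  finally show ?thesis by (simp add: D_def Du_def d_def)
qed

text \<open>The exponent \<open>\<gamma>\<close> turns the left side of the Gagliardo-Nirenberg
  inequality for \<open>\<bar>f\<bar> powr \<gamma>\<close> into
  \<open>\<Sum>x. (f x)\<^sup>2 = 1\<close>, so the gradient sum \<open>D\<close> is at least 1.
  Each increment is at most twice the product of \<open>m powr (\<gamma> - 1)\<close>,
  \<open>\<rho>\<close> and the weighted increment of \<open>f\<close>, and Hoelder's inequality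
  separates the three factors.\<close>

lemma weighted_Poincare:
  fixes f \<rho> :: "int ^ 'd::finite \<Rightarrow> real" and P :: real
  assumes d: "CARD('d) \<ge> 2" and supp: "{x. f x \<noteq> 0} \<subseteq> box n" and norm: "(\<Sum>x\<in>box n. (f x)\<^sup>2) = 1"
    and \<rho>: "\<And>x. \<rho> x > 0" and P: "(\<Sum>x\<in>box (Suc n). \<rho> x ^ CARD('d)) \<le> P"
  shows "1 \<le> (4 * CARD('d) * (CARD('d) * P) powr (1 / CARD('d)))\<^sup>2 *
    (\<Sum>x\<in>box (Suc n). \<Sum>i\<in>UNIV. ((f (x + basis i) - f x) / \<rho> x)\<^sup>2)"
proof -
  define d where "d = CARD('d)"
  have d2: "d \<ge> 2" using d by (simp add: d_def)
  define \<gamma> :: real where "\<gamma> = 2 * (d - 1) / d"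
  define u where "u x = \<bar>f x\<bar> powr \<gamma>" for x
  define D where "D = (\<Sum>x\<in>box (Suc n). \<Sum>i\<in>UNIV. \<bar>u (x + basis i) - u x\<bar>)"
  define G where "G = (\<Sum>x\<in>box (Suc n). \<Sum>i\<in>UNIV. ((f (x + basis i) - f x) / \<rho> x)\<^sup>2)"
  have \<gamma>: "1 \<le> \<gamma>" "\<gamma> \<le> 2" "\<gamma> - 1 = (d - 2) / d" using d2 by (auto simp: \<gamma>_def field_simps of_nat_diff)
  have upow: "u x powr (d / (d - 1)) = (f x)\<^sup>2" for x
  proof -
    have "\<gamma> * (d / (d - 1)) = 2" using d2 by (simp add: \<gamma>_def field_simps of_nat_diff)
    then show ?thesis unfolding u_def powr_powr by (cases "f x = 0") auto
  qed
  have "1 = (\<Sum>x\<in>box n. u x powr (d / (d - 1)))" by (simp only: upow norm)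
  also have "\<dots> \<le> D powr (d / (d - 1))" unfolding D_def d_def
    using supp by (intro Gagliardo_Nirenberg_lattice d) (auto simp: u_def)
  finally have "1 \<le> D powr (d / (d - 1))" .
  moreover have D0: "D \<ge> 0" by (auto simp: D_def intro!: sum_nonneg)
  ultimately have D1: "1 \<le> D"
    using powr_less_mono2[of "d / (d - 1)" D 1] d2 by (cases "D < 1") auto
  define S where "S = (box (Suc n) :: (int ^ 'd) set) \<times> (UNIV :: 'd set)"
  have finS: "finite S" by (simp add: S_def)
  define m where "m p = max \<bar>f (fst p)\<bar> \<bar>f (fst p + basis (snd p))\<bar>" for p
  define F :: "nat \<Rightarrow> (int ^ 'd) \<times> 'd \<Rightarrow> real" where
    "F k p = (if k = 0 then (m p)\<^sup>2 else if k = 1 then \<rho> (fst p) ^ d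
      else ((f (fst p + basis (snd p)) - f (fst p)) / \<rho> (fst p))\<^sup>2)" for k p
  \<comment> \<open>The weights add up to 1. For \<open>d = 2\<close> the first one is 0, which is
    consistent with \<open>a powr (\<gamma> - 1)\<close> at \<open>a = 0\<close> because both are
    \<open>0 powr 0 = 0\<close>.\<close>
  define \<theta> :: "nat \<Rightarrow> real" where "\<theta> k = (if k = 0 then (d - 2) / (2 * d) else if k = 1 then 1 / d else 1 / 2)" for k
  have I: "{..<3::nat} = {0, 1, 2}" by auto
  have "D = (\<Sum>p\<in>S. \<bar>u (fst p + basis (snd p)) - u (fst p)\<bar>)"
    unfolding D_def S_def by (simp add: sum.cartesian_product case_prod_beta)
  also have "\<dots> \<le> (\<Sum>p\<in>S. 2 * (\<Prod>k\<in>{..<3}. F k p powr \<theta> k))"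
  proof (rule sum_mono)
    fix p assume "p \<in> S"
    define a b where "a = max \<bar>f (fst p)\<bar> \<bar>f (fst p + basis (snd p))\<bar>"
      and "b = min \<bar>f (fst p)\<bar> \<bar>f (fst p + basis (snd p))\<bar>"
    define g where "g = \<bar>f (fst p + basis (snd p)) - f (fst p)\<bar>"
    have "\<bar>u (fst p + basis (snd p)) - u (fst p)\<bar> = a powr \<gamma> - b powr \<gamma>"
      using powr_mono2[of \<gamma> "\<bar>f (fst p)\<bar>" "\<bar>f (fst p + basis (snd p))\<bar>"]
        powr_mono2[of \<gamma> "\<bar>f (fst p + basis (snd p))\<bar>" "\<bar>f (fst p)\<bar>"] \<gamma>
      by (auto simp: a_def b_def u_def max_def min_def)
    also have "\<dots> \<le> 2 * a powr (\<gamma> - 1) * (a - b)"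
      by (intro powr_diff_le \<gamma>) (auto simp: a_def b_def)
    also have "\<dots> \<le> 2 * (a powr (\<gamma> - 1) * g)"
      unfolding mult.assoc by (intro mult_left_mono) (auto simp: a_def b_def g_def)
    also have "a powr (\<gamma> - 1) * g = (\<Prod>k\<in>{..<3}. F k p powr \<theta> k)"
    proof -
      have "F 0 p powr \<theta> 0 = (a powr 2) powr ((d - 2) / (2 * d))"
        by (simp add: F_def \<theta>_def m_def a_def)
      also have "\<dots> = a powr (\<gamma> - 1)"
        unfolding powr_powr \<gamma>(3) by simp
      finally have 0: "F 0 p powr \<theta> 0 = a powr (\<gamma> - 1)" .
      have "F 1 p powr \<theta> 1 = (\<rho> (fst p) powr d) powr (1 / d)"
        using \<rho> by (simp add: F_def \<theta>_def powr_realpow)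
      also have "\<dots> = \<rho> (fst p)" using d2 \<rho>[of "fst p"] by (simp add: powr_powr)
      finally have 1: "F 1 p powr \<theta> 1 = \<rho> (fst p)" .
      have "F 2 p powr \<theta> 2 = g / \<rho> (fst p)"
        using \<rho>[of "fst p"] by (simp add: F_def \<theta>_def powr_half_sqrt g_def)
      then show ?thesis using 0 1 \<rho>[of "fst p"] unfolding I by (simp add: less_imp_neq[THEN not_sym])
    qed
    finally show "\<bar>u (fst p + basis (snd p)) - u (fst p)\<bar> \<le> 2 * (\<Prod>k\<in>{..<3}. F k p powr \<theta> k)"
      by simp
  qed
  also have "\<dots> = 2 * (\<Sum>p\<in>S. \<Prod>k\<in>{..<3}. F k p powr \<theta> k)" by (simp add: sum_distrib_left)
  also have "\<dots> \<le> 2 * (\<Prod>k\<in>{..<3}. (\<Sum>p\<in>S. F k p) powr \<theta> k)"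
    by (intro mult_left_mono Holder_sum_prod finS)
      (use d2 \<rho> in \<open>auto simp: F_def \<theta>_def I less_imp_le field_simps of_nat_diff\<close>)
  also have "\<dots> \<le> 2 * ((2 * d) * (d * P) powr (1 / d) * sqrt G)"
  proof -
    \<comment> \<open>The squared maximum is at most the sum of the squares at both ends, and each
      end contributes at most the norm 1 for every direction: \<open>2 * d\<close> in total.\<close>
    have "(\<Sum>p\<in>S. F 0 p) \<le> (\<Sum>p\<in>S. (f (fst p))\<^sup>2 + (f (fst p + basis (snd p)))\<^sup>2)"
      by (intro sum_mono) (auto simp: F_def m_def max_def)
    also have "\<dots> = (\<Sum>i\<in>(UNIV::'d set). (\<Sum>x\<in>box (Suc n). (f x)\<^sup>2) + (\<Sum>x\<in>box (Suc n). (f (x + basis i))\<^sup>2))"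
      unfolding S_def sum.cartesian_product' by (subst sum.swap) (simp add: sum.distrib)
    also have "\<dots> \<le> (\<Sum>i\<in>(UNIV::'d set). 1 + 1)"
    proof (intro sum_mono add_mono)
      have "(\<Sum>x\<in>box (Suc n). (f x)\<^sup>2) = (\<Sum>x\<in>box n. (f x)\<^sup>2)"
        using supp by (intro sum.mono_neutral_right) (auto intro!: box_mono)
      then show "(\<Sum>x\<in>box (Suc n). (f x)\<^sup>2) \<le> 1" using norm by simp
    next
      fix i :: 'd
      have "(\<Sum>x\<in>box (Suc n). (f (x + basis i))\<^sup>2) = (\<Sum>x\<in>(\<lambda>x. x + basis i) ` box (Suc n). (f x)\<^sup>2)"
        by (subst sum.reindex) auto
      also have "\<dots> \<le> (\<Sum>x\<in>(\<lambda>x. x + basis i) ` box (Suc n) \<union> box n. (f x)\<^sup>2)"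
        by (intro sum_mono2) auto
      also have "\<dots> = (\<Sum>x\<in>box n. (f x)\<^sup>2)"
        using supp by (intro sum.mono_neutral_right) auto
      finally show "(\<Sum>x\<in>box (Suc n). (f (x + basis i))\<^sup>2) \<le> 1" using norm by simp
    qed
    finally have A: "(\<Sum>p\<in>S. F 0 p) \<le> 2 * d" by (simp add: d_def)
    have A0: "(\<Sum>p\<in>S. F 0 p) \<ge> 0" by (intro sum_nonneg) (auto simp: F_def)
    have "(\<Sum>p\<in>S. F 0 p) powr \<theta> 0 \<le> (2 * d) powr \<theta> 0"
      using A A0 by (intro powr_mono2) (auto simp: \<theta>_def)
    also have "\<dots> \<le> (2 * d) powr 1" using d2 by (intro powr_mono) (auto simp: \<theta>_def field_simps)
    finally have 0: "(\<Sum>p\<in>S. F 0 p) powr \<theta> 0 \<le> 2 * d" using d2 by simp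
    have "(\<Sum>p\<in>S. F 1 p) = d * (\<Sum>x\<in>box (Suc n). \<rho> x ^ d)"
      unfolding S_def sum.cartesian_product'
      by (simp add: F_def d_def sum_distrib_left)
    also have "\<dots> \<le> d * P" using P by (intro mult_left_mono) (auto simp: d_def)
    finally have "(\<Sum>p\<in>S. F 1 p) powr \<theta> 1 \<le> (d * P) powr \<theta> 1"
      using \<rho> by (intro powr_mono2 sum_nonneg) (auto simp: \<theta>_def F_def less_imp_le)
    then have 1: "(\<Sum>p\<in>S. F 1 p) powr \<theta> 1 \<le> (d * P) powr (1 / d)" by (simp add: \<theta>_def)
    have "(\<Sum>p\<in>S. F 2 p) = G"
      unfolding S_def G_def sum.cartesian_product' by (simp add: F_def)
    then have 2: "(\<Sum>p\<in>S. F 2 p) powr \<theta> 2 \<le> sqrt G"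
      by (simp add: \<theta>_def powr_half_sqrt G_def sum_nonneg)
    have "(\<Prod>k\<in>{..<3}. (\<Sum>p\<in>S. F k p) powr \<theta> k)
      = (\<Sum>p\<in>S. F 0 p) powr \<theta> 0 * (\<Sum>p\<in>S. F 1 p) powr \<theta> 1 * (\<Sum>p\<in>S. F 2 p) powr \<theta> 2"
      unfolding I by (simp add: mult.assoc)
    also have "\<dots> \<le> (2 * d) * (d * P) powr (1 / d) * sqrt G"
      by (intro mult_mono 0 1 2) auto
    finally show ?thesis by (simp add: mult_ac)
  qed
  finally have "D \<le> 4 * d * (d * P) powr (1 / d) * sqrt G" by simp
  with D1 have "1 \<le> 4 * d * (d * P) powr (1 / d) * sqrt G" by linarith
  then have "1\<^sup>2 \<le> (4 * d * (d * P) powr (1 / d) * sqrt G)\<^sup>2" by (intro power_mono) auto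
  also have "\<dots> = (4 * d * (d * P) powr (1 / d))\<^sup>2 * G"
    by (simp add: power_mult_distrib G_def sum_nonneg)
  finally show ?thesis by (simp add: G_def d_def)
qed

section \<open>Edge-disjoint routes between neighbours\<close>

lemma adj_add_basis: "adj (x :: int ^ 'd::finite) (x + basis i)" "adj (x + basis i) x"
proof -
  have "\<bar>x $ j - (x + basis i) $ j\<bar> = (if j = i then 1 else 0)"
    "\<bar>(x + basis i) $ j - x $ j\<bar> = (if j = i then 1 else 0)" for j
    by (auto simp: axis_def)
  then show "adj x (x + basis i)" "adj (x + basis i) x"
    unfolding adj_def by simp_all
qed

lemma adj_sym: "adj x y \<Longrightarrow> adj y (x :: int ^ 'd::finite)"
  unfolding adj_def by (simp add: abs_minus_commute)

lemma adj_diff_le_1: "adj x y \<Longrightarrow> \<bar>x $ i - y $ i\<bar> \<le> 1" for x y :: "int ^ 'd::finite"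
  unfolding adj_def using member_le_sum[of i UNIV "\<lambda>i. \<bar>x $ i - y $ i\<bar>"] by simp

text \<open>The routes built below stay within sup-distance 2 of \<open>x\<close> when
  \<open>i \<noteq> k\<close>, so radius 3 contains them; it also makes the edge sets of sites at
  sup-distance more than 6 disjoint.\<close>

definition nbhd :: "int ^ 'd \<Rightarrow> (int ^ 'd) set set" where
  "nbhd x = {e \<in> edges. \<forall>y\<in>e. \<forall>i. \<bar>y $ i - x $ i\<bar> \<le> 3}"

definition steps :: "'a list \<Rightarrow> ('a \<times> 'a) set" where
  "steps xs = set (zip xs (tl xs))"

text \<open>The index \<open>(j, b)\<close> with \<open>j \<noteq> i\<close> is the detour through the neighbour in direction \<open>\<plusminus>e\<^sub>j\<close>, \<open>(i, True)\<close> the edge itself,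
and \<open>(i, False)\<close> an outer loop in the \<open>(i, k)\<close>-plane leaving \<open>x\<close> backwards and entering \<open>x + e\<^sub>i\<close> from the front.\<close>

definition route :: "int ^ 'd \<Rightarrow> 'd \<Rightarrow> 'd \<Rightarrow> 'd \<times> bool \<Rightarrow> (int ^ 'd) list" where
  "route x i k \<kappa> = map ((+) x) (
    let s = (if snd \<kappa> then basis (fst \<kappa>) else - basis (fst \<kappa>)) in
    if fst \<kappa> = i then
      if snd \<kappa> then [0, basis i]
      else [0, - basis i, - basis i + basis k, - basis i + basis k + basis k, basis k + basis k,
        basis i + basis k + basis k, basis i + basis i + basis k + basis k,
        basis i + basis i + basis k, basis i + basis i, basis i]
    else [0, s, s + basis i, basis i])"

lemma route_ends: "route x i k \<kappa> \<noteq> []" "hd (route x i k \<kappa>) = x" "last (route x i k \<kappa>) = x + basis i"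
  "length (route x i k \<kappa>) \<le> 10"
  by (auto simp: route_def Let_def)

lemma adjI: "b - a = basis j \<or> a - b = basis j \<Longrightarrow> adj a b" for a b :: "int ^ 'd::finite"
  using adj_add_basis by (metis add_diff_cancel_left' diff_add_cancel add.commute)

lemma route_adj:
  fixes x :: "int ^ 'd::finite"
  assumes "(a, b) \<in> steps (route x i k \<kappa>)"
  shows "adj a b"
proof -
  have "\<exists>j. b - a = basis j \<or> a - b = basis j"
    using assms
    by (cases \<kappa>) (auto simp: steps_def route_def Let_def split: if_splits)
  then show ?thesis using adjI by blast
qed

lemma route_near:
  fixes x :: "int ^ 'd::finite"
  assumes "a \<in> set (route x i k \<kappa>)" "i \<noteq> k"
  shows "\<bar>a $ l - x $ l\<bar> \<le> 3"
  using assms by (cases \<kappa>) (auto simp: route_def Let_def axis_def split: if_splits)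

text \<open>The sum of the endpoints depends only on the undirected edge and determines the route containing it.\<close>

lemma route_midpoint:
  fixes x :: "int ^ 'd::finite"
  assumes "(a, b) \<in> steps (route x i k \<kappa>)" "i \<noteq> k"
  defines "s \<equiv> (a - x) + (b - x)"
  shows "if fst \<kappa> = i then
      (if snd \<kappa> then s = basis i else s $ i \<notin> {0, 1, 2} \<or> s $ k = 4)
    else s $ i \<in> {0, 1, 2} \<and> s $ fst \<kappa> \<in> (if snd \<kappa> then {1, 2} else {-1, -2})
      \<and> (\<forall>l. l \<noteq> i \<and> l \<noteq> fst \<kappa> \<longrightarrow> s $ l = 0)"
  using assms(1,2) unfolding s_def
  by (cases \<kappa>) (auto simp: steps_def route_def Let_def axis_def split: if_splits)

lemma route_edge_disjoint:
  fixes x :: "int ^ 'd::finite"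
  assumes "(a, b) \<in> steps (route x i k \<kappa>)" "(a', b') \<in> steps (route x i k \<kappa>')" "i \<noteq> k" "{a, b} = {a', b'}"
  shows "\<kappa> = \<kappa>'"
proof -
  define s where "s = (a - x) + (b - x)"
  have s': "s = (a' - x) + (b' - x)" using assms(4) unfolding s_def doubleton_eq_iff by auto
  note M = route_midpoint[OF assms(1,3), folded s_def] route_midpoint[OF assms(2,3), folded s']
  \<comment> \<open>The direct edge has \<open>s $ i = 1\<close> and no other nonzero entry, which
    excludes the outer loop (there \<open>s $ i\<close> is outside \<open>{0, 1, 2}\<close> or
    \<open>s $ k = 4\<close>) and every detour (there another entry is nonzero).\<close>
  have bi: "s = basis i \<Longrightarrow> s $ i = 1 \<and> (\<forall>l. l \<noteq> i \<longrightarrow> s $ l = 0)" by (auto simp: axis_def)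
  obtain j b j' b' where \<kappa>: "\<kappa> = (j, b)" "\<kappa>' = (j', b')" by (metis surj_pair)
  show ?thesis
    using M bi assms(3) unfolding \<kappa>
    by (cases "j = i"; cases "j' = i"; cases "j = j'"; cases b; cases b'; simp; force)
qed

text \<open>Pigeonhole: if each of the \<open>2 * CARD('d)\<close> routes had an edge of conductance
  at most \<open>s\<close>, choosing one per route would be injective by edge-disjointness and give
  too many such edges in \<open>nbhd x\<close>.\<close>

lemma good_route:
  fixes x :: "int ^ 'd::finite" and w :: "(int ^ 'd) set \<Rightarrow> real"
  assumes d: "CARD('d) \<ge> 2" and fin: "finite (nbhd x)" and bad: "card {e \<in> nbhd x. w e \<le> s} < 2 * CARD('d)"
  obtains xs where "xs \<noteq> []" "hd xs = x" "last xs = x + basis i" "length xs \<le> 10"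
    "\<And>a b. (a, b) \<in> steps xs \<Longrightarrow> adj a b \<and> {a, b} \<in> nbhd x \<and> s < w {a, b}"
proof -
  obtain k where ik: "i \<noteq> k"
  proof -
    have "card {i} < CARD('d)" using d by simp
    then have "{i} \<noteq> UNIV" by (metis less_irrefl)
    then obtain k where "k \<notin> {i}" by blast
    then show ?thesis using that[of k] by simp
  qed
  have near: "{a, b} \<in> nbhd x" if "(a, b) \<in> steps (route x i k \<kappa>)" for a b \<kappa>
  proof -
    have "a \<in> set (route x i k \<kappa>)" "b \<in> set (route x i k \<kappa>)"
      using that by (auto simp: steps_def dest: set_zip_leftD set_zip_rightD list.set_sel(2)[OF route_ends(1)])
    then show ?thesis using route_near[OF _ ik] route_adj[OF that] by (auto simp: nbhd_def edges_def)
  qed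
  have "\<exists>\<kappa>. \<forall>(a, b) \<in> steps (route x i k \<kappa>). s < w {a, b}"
  proof (rule ccontr)
    assume "\<not> ?thesis"
    then have "\<forall>\<kappa>. \<exists>p. p \<in> steps (route x i k \<kappa>) \<and> w {fst p, snd p} \<le> s"
      by (auto simp: not_less split_beta) fastforce
    then obtain p where p: "\<And>\<kappa>. p \<kappa> \<in> steps (route x i k \<kappa>)" "\<And>\<kappa>. w {fst (p \<kappa>), snd (p \<kappa>)} \<le> s"
      by metis
    define e where "e \<kappa> = {fst (p \<kappa>), snd (p \<kappa>)}" for \<kappa>
    have "inj e"
    proof (rule injI)
      fix \<kappa> \<kappa>' assume "e \<kappa> = e \<kappa>'"
      then show "\<kappa> = \<kappa>'"
        using route_edge_disjoint[OF _ _ ik, of "fst (p \<kappa>)" "snd (p \<kappa>)" x \<kappa> "fst (p \<kappa>')" "snd (p \<kappa>')" \<kappa>'] p(1)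
        by (simp add: e_def)
    qed
    moreover have "range e \<subseteq> {e \<in> nbhd x. w e \<le> s}"
      using near p by (auto simp: e_def) (metis prod.collapse)
    ultimately have "card (UNIV :: ('d \<times> bool) set) \<le> card {e \<in> nbhd x. w e \<le> s}"
      using fin by (intro card_inj_on_le[of e]) auto
    then show False using bad by (simp add: card_prod)
  qed
  then obtain \<kappa> where \<kappa>: "\<And>a b. (a, b) \<in> steps (route x i k \<kappa>) \<Longrightarrow> s < w {a, b}" by blast
  show ?thesis
    by (rule that[of "route x i k \<kappa>"]) (auto simp: route_ends intro: route_adj near \<kappa>)
qed

section \<open>Local energies and the deterministic lower bound on the energy\<close>

lemma abs_diff_along_steps:
  fixes f :: "'a \<Rightarrow> real" and q :: real
  assumes "xs \<noteq> []" "\<And>a b. (a, b) \<in> steps xs \<Longrightarrow> \<bar>f b - f a\<bar> \<le> q"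
  shows "\<bar>f (last xs) - f (hd xs)\<bar> \<le> (length xs - 1) * q"
  using assms
proof (induction xs rule: induct_list012)
  case (3 x y zs)
  have "\<bar>f (last (y # zs)) - f (hd (y # zs))\<bar> \<le> (length (y # zs) - 1) * q"
    using 3 by (intro 3) (auto simp: steps_def)
  moreover have "\<bar>f y - f x\<bar> \<le> q" using 3 by (auto simp: steps_def)
  ultimately show ?case by (auto simp: algebra_simps)
qed (auto simp: steps_def)

text \<open>Both orientations of each edge are kept, matching the sum over ordered pairs in
  \<open>energy\<close>.\<close>

definition pairs :: "int ^ 'd \<Rightarrow> ((int ^ 'd) \<times> (int ^ 'd)) set" where
  "pairs x = {(a, b). adj a b \<and> {a, b} \<in> nbhd x}"

lemma finite_cube: "finite {y :: int ^ 'd::finite. \<forall>i. \<bar>y $ i - x $ i\<bar> \<le> r}"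
  and card_cube: "r \<ge> 0 \<Longrightarrow> card {y :: int ^ 'd. \<forall>i. \<bar>y $ i - x $ i\<bar> \<le> r} = nat (2 * r + 1) ^ CARD('d)"
proof -
  have eq: "{y :: int ^ 'd. \<forall>i. \<bar>y $ i - x $ i\<bar> \<le> r} = {y. \<forall>i. y $ i \<in> {x $ i - r..x $ i + r}}"
    by (intro Collect_cong all_cong1) auto
  show "finite {y :: int ^ 'd. \<forall>i. \<bar>y $ i - x $ i\<bar> \<le> r}"
    unfolding eq by (intro card_vec_prod(2)) auto
  show "card {y :: int ^ 'd. \<forall>i. \<bar>y $ i - x $ i\<bar> \<le> r} = nat (2 * r + 1) ^ CARD('d)" if "r \<ge> 0"
    unfolding eq by (subst card_vec_prod(1)) (simp add: algebra_simps)
qed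

lemma finite_pairs: "finite (pairs (x :: int ^ 'd::finite))"
proof (rule finite_subset)
  let ?Q = "{y. \<forall>i. \<bar>y $ i - x $ i\<bar> \<le> 3}"
  show "pairs x \<subseteq> ?Q \<times> ?Q" by (auto simp: pairs_def nbhd_def)
  show "finite (?Q \<times> ?Q)" using finite_cube by blast
qed

lemma nbhd_eq_pairs: "nbhd x = (\<lambda>(a, b). {a, b}) ` pairs (x :: int ^ 'd::finite)"
  by (auto simp: pairs_def nbhd_def edges_def image_iff)

lemma finite_nbhd: "finite (nbhd (x :: int ^ 'd::finite))"
  unfolding nbhd_eq_pairs by (intro finite_imageI finite_pairs)

text \<open>Pairs with both ends outside the box contribute nothing. Leaving \<open>Q\<close> free
  allows it to be enlarged by the sets \<open>pairs x\<close> later.\<close>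

lemma energy_finite_sum:
  fixes f :: "int ^ 'd::finite \<Rightarrow> real"
  assumes "{x. f x \<noteq> 0} \<subseteq> box n" "finite Q" "Q \<subseteq> {(x, y). adj x y}"
    "{(x, y). adj x y \<and> (x \<in> box n \<or> y \<in> box n)} \<subseteq> Q"
  shows "energy w f = (\<Sum>(x, y)\<in>Q. w {x, y} * (f x - f y)\<^sup>2) / 2"
proof -
  have "(\<Sum>\<^sub>\<infinity>(x, y)\<in>{(x, y). adj x y}. w {x, y} * (f x - f y)^2)
    = (\<Sum>\<^sub>\<infinity>(x, y)\<in>Q. w {x, y} * (f x - f y)^2)"
  proof (rule infsum_cong_neutral)
    fix p assume p: "p \<in> {(x, y). adj x y} - Q"
    obtain a b where ab: "p = (a, b)" by (cases p)
    then have "a \<notin> box n" "b \<notin> box n" using p assms(4) by auto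
    then have "f a = 0" "f b = 0" using assms(1) by auto
    then show "(case p of (x, y) \<Rightarrow> w {x, y} * (f x - f y)\<^sup>2) = 0" by (simp add: ab)
  qed (use assms(3) in auto)
  then show ?thesis using assms(2) by (simp add: energy_def)
qed

lemma box_adj:
  fixes x y :: "int ^ 'd::finite"
  assumes "adj x y" "x \<in> box n"
  shows "y \<in> box (Suc n)"
proof -
  have "\<bar>y $ i\<bar> \<le> int (Suc n)" for i
  proof -
    have "\<bar>x $ i\<bar> \<le> int n" using assms(2) by (simp add: box_def)
    then show ?thesis using adj_diff_le_1[OF assms(1), of i] by arith
  qed
  then show ?thesis by (simp add: box_def)
qed

lemma adj_box_subset:
  "{(x, y). adj x y \<and> (x \<in> box n \<or> y \<in> box n)} \<subseteq> {(x, y). adj x y} \<inter> box (Suc n) \<times> (box (Suc n) :: (int ^ 'd::finite) set)"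
  using box_mono[of n "Suc n"] by (auto dest: box_adj box_adj[OF adj_sym])

text \<open>An edge lies in \<open>nbhd x\<close> for at most \<open>7 ^ CARD('d)\<close> sites
  \<open>x\<close>, those within sup-distance 3 of one of its ends; the factor 2 undoes the
  \<open>1/2\<close> in \<open>energy\<close>.\<close>

lemma sum_pairs_le_energy:
  fixes f :: "int ^ 'd::finite \<Rightarrow> real"
  assumes w: "\<And>e. e \<in> edges \<Longrightarrow> 0 \<le> w e" and supp: "{x. f x \<noteq> 0} \<subseteq> box n" and X: "finite X"
  shows "(\<Sum>x\<in>X. \<Sum>(a, b)\<in>pairs x. w {a, b} * (f a - f b)\<^sup>2) \<le> 2 * 7 ^ CARD('d) * energy w f"
proof -
  define \<phi> where "\<phi> p = (case p of (a, b) \<Rightarrow> w {a, b} * (f a - f b)\<^sup>2)" for p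
  define Q where "Q = (\<Union>x\<in>X. pairs x) \<union> ({(x, y). adj x y} \<inter> box (Suc n) \<times> box (Suc n))"
  have finQ: "finite Q" using X finite_pairs by (auto simp: Q_def)
  have Qadj: "Q \<subseteq> {(x, y). adj x y}" by (auto simp: Q_def pairs_def)
  have \<phi>0: "\<phi> p \<ge> 0" if "p \<in> Q" for p
    using that Qadj w by (cases p) (auto simp: \<phi>_def edges_def intro!: mult_nonneg_nonneg)
  have "(\<Sum>x\<in>X. \<Sum>p\<in>pairs x. \<phi> p) = (\<Sum>x\<in>X. \<Sum>p\<in>Q. if p \<in> pairs x then \<phi> p else 0)"
  proof (rule sum.cong[OF refl])
    fix x assume "x \<in> X"
    then have "Q \<inter> pairs x = pairs x" by (auto simp: Q_def)
    then show "(\<Sum>p\<in>pairs x. \<phi> p) = (\<Sum>p\<in>Q. if p \<in> pairs x then \<phi> p else 0)"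
      using sum.inter_restrict[OF finQ, of \<phi> "pairs x"] by simp
  qed
  also have "\<dots> = (\<Sum>p\<in>Q. \<Sum>x\<in>X. if p \<in> pairs x then \<phi> p else 0)" by (rule sum.swap)
  also have "\<dots> \<le> (\<Sum>p\<in>Q. 7 ^ CARD('d) * \<phi> p)"
  proof (rule sum_mono)
    fix p assume p: "p \<in> Q"
    have "card (X \<inter> {x. p \<in> pairs x}) \<le> card {x. \<forall>i. \<bar>x $ i - fst p $ i\<bar> \<le> 3}"
      by (intro card_mono finite_cube) (auto simp: pairs_def nbhd_def abs_minus_commute)
    also have "\<dots> = 7 ^ CARD('d)" by (subst card_cube) auto
    finally have "real (card (X \<inter> {x. p \<in> pairs x})) \<le> 7 ^ CARD('d)"
      by (metis of_nat_le_iff of_nat_numeral of_nat_power)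
    then show "(\<Sum>x\<in>X. if p \<in> pairs x then \<phi> p else 0) \<le> 7 ^ CARD('d) * \<phi> p"
      using \<phi>0[OF p] X by (simp add: sum.If_cases mult_right_mono)
  qed
  also have "\<dots> = 7 ^ CARD('d) * (\<Sum>p\<in>Q. \<phi> p)" by (simp add: sum_distrib_left)
  also have "(\<Sum>p\<in>Q. \<phi> p) = 2 * energy w f"
  proof -
    have "{(x, y). adj x y \<and> (x \<in> box n \<or> y \<in> box n)} \<subseteq> Q"
      using adj_box_subset[of n] unfolding Q_def by blast
    from energy_finite_sum[OF supp finQ Qadj this, of w] show ?thesis by (simp add: \<phi>_def)
  qed
  finally show ?thesis by (simp add: \<phi>_def)
qed

text \<open>A good route has at most 9 steps of conductance above \<open>t (R x)\<close>, so the
  squared increment of \<open>f\<close> at \<open>x\<close> is at most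
  \<open>81 * E x / t (R x)\<close>. Assumption \<open>U\<close> says that dividing by
  \<open>(\<rho> x)\<^sup>2\<close> replaces \<open>1 / t (R x)\<close> by at most
  \<open>K / t n\<close>, uniformly in \<open>x\<close>; then \<open>weighted_Poincare\<close> and
  the overlap bound for local energies finish. The constant 162 is \<open>2 * 81\<close>.\<close>

lemma energy_ge_of_local_scales:
  fixes f :: "int ^ 'd::finite \<Rightarrow> real" and R :: "int ^ 'd \<Rightarrow> nat" and t :: "nat \<Rightarrow> real" and K P :: real
  assumes d: "CARD('d) \<ge> 2" and w: "\<And>e. e \<in> edges \<Longrightarrow> 0 \<le> w e"
    and supp: "{x. f x \<noteq> 0} \<subseteq> box n" and norm: "(\<Sum>x\<in>box n. (f x)\<^sup>2) = 1"
    and n: "n \<ge> 1" and t: "\<And>m. t m > 0"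
    and U: "\<And>r. r \<le> n \<Longrightarrow> (real n)\<^sup>2 * t n \<le> K * (real r + 1)\<^sup>2 * t r"
    and R: "\<And>x. x \<in> box (Suc n) \<Longrightarrow> R x \<le> n"
    and good: "\<And>x. x \<in> box (Suc n) \<Longrightarrow> card {e \<in> nbhd x. w e \<le> t (R x)} < 2 * CARD('d)"
    and P: "(\<Sum>x\<in>box (Suc n). (real (R x) + 1) ^ CARD('d)) \<le> P * real n ^ CARD('d)"
  shows "t n \<le> (4 * CARD('d) * (CARD('d) * P) powr (1 / CARD('d)))\<^sup>2 * (162 * CARD('d) * K * 7 ^ CARD('d)) * energy w f"
proof -
  \<comment> \<open>The \<open>+ 1\<close> keeps the weight positive where
    \<open>R x = 0\<close>.\<close>
  define \<rho> where "\<rho> x = (real (R x) + 1) / real n" for x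
  define E where "E x = (\<Sum>(a, b)\<in>pairs x. w {a, b} * (f a - f b)\<^sup>2)" for x
  define A where "A = (4 * CARD('d) * (CARD('d) * P) powr (1 / CARD('d)))\<^sup>2"
  have \<phi>0: "0 \<le> (case p of (a, b) \<Rightarrow> w {a, b} * (f a - f b)\<^sup>2)" if "p \<in> pairs x" for p x
    using that w by (cases p) (auto simp: pairs_def edges_def intro!: mult_nonneg_nonneg)
  have E0: "E x \<ge> 0" for x unfolding E_def by (intro sum_nonneg \<phi>0)
  have local_bound: "((f (x + basis i) - f x) / \<rho> x)\<^sup>2 \<le> 81 * K / t n * E x" if x: "x \<in> box (Suc n)" for x i
  proof -
    obtain xs where xs: "xs \<noteq> []" "hd xs = x" "last xs = x + basis i" "length xs \<le> 10"
      "\<And>a b. (a, b) \<in> steps xs \<Longrightarrow> adj a b \<and> {a, b} \<in> nbhd x \<and> t (R x) < w {a, b}"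
      using good_route[OF d finite_nbhd good[OF x]] by metis
    define q where "q = sqrt (E x / t (R x))"
    have q0: "q \<ge> 0" using E0[of x] t[of "R x"] by (simp add: q_def)
    have "\<bar>f b - f a\<bar> \<le> q" if ab: "(a, b) \<in> steps xs" for a b
    proof -
      have "t (R x) * (f a - f b)\<^sup>2 \<le> w {a, b} * (f a - f b)\<^sup>2"
        using xs(5)[OF ab] by (intro mult_right_mono) auto
      also have "\<dots> \<le> E x" unfolding E_def
        using member_le_sum[of "(a, b)" "pairs x" "\<lambda>(a, b). w {a, b} * (f a - f b)\<^sup>2"] xs(5)[OF ab] \<phi>0
        by (auto simp: pairs_def finite_pairs[unfolded pairs_def])
      finally have "(f a - f b)\<^sup>2 \<le> E x / t (R x)" using t[of "R x"] by (simp add: field_simps)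
      then have "sqrt ((f a - f b)\<^sup>2) \<le> q" unfolding q_def by (rule real_sqrt_le_mono)
      then show ?thesis by (simp add: abs_minus_commute)
    qed
    then have "\<bar>f (x + basis i) - f x\<bar> \<le> (length xs - 1) * q"
      using abs_diff_along_steps[OF xs(1), of f q] xs(2,3) by simp
    also have "\<dots> \<le> 9 * q" using xs(4) q0 by (intro mult_right_mono) auto
    finally have "\<bar>f (x + basis i) - f x\<bar>\<^sup>2 \<le> (9 * q)\<^sup>2" by (intro power_mono) auto
    also have "\<dots> = 81 * (E x / t (R x))" using E0[of x] t[of "R x"] by (simp add: q_def power_mult_distrib)
    finally have 1: "(f (x + basis i) - f x)\<^sup>2 \<le> 81 * (E x / t (R x))" by simp
    have "((f (x + basis i) - f x) / \<rho> x)\<^sup>2 = (f (x + basis i) - f x)\<^sup>2 * ((real n)\<^sup>2 / (real (R x) + 1)\<^sup>2)"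
      by (simp add: \<rho>_def power_divide power_mult_distrib)
    also have "\<dots> \<le> 81 * (E x / t (R x)) * ((real n)\<^sup>2 / (real (R x) + 1)\<^sup>2)"
      by (intro mult_right_mono 1) auto
    also have "\<dots> = 81 * E x * ((real n)\<^sup>2 / ((real (R x) + 1)\<^sup>2 * t (R x)))" by simp
    also have "\<dots> \<le> 81 * E x * (K / t n)"
    proof (intro mult_left_mono)
      have "(real (R x) + 1)\<^sup>2 * t (R x) > 0" using t by (simp add: zero_less_mult_iff add_nonneg_pos)
      then show "(real n)\<^sup>2 / ((real (R x) + 1)\<^sup>2 * t (R x)) \<le> K / t n"
        using U[OF R[OF x]] t[of n] by (simp add: field_simps)
    qed (use E0 in auto)
    finally show ?thesis by (simp add: mult_ac)
  qed
  have "1 \<le> A * (\<Sum>x\<in>box (Suc n). \<Sum>i\<in>UNIV. ((f (x + basis i) - f x) / \<rho> x)\<^sup>2)"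
    unfolding A_def
  proof (rule weighted_Poincare[OF d supp norm])
    show "\<rho> x > 0" for x using n by (simp add: \<rho>_def add_nonneg_pos)
    show "(\<Sum>x\<in>box (Suc n). \<rho> x ^ CARD('d)) \<le> P"
      using P n by (simp add: \<rho>_def power_divide sum_divide_distrib[symmetric] field_simps)
  qed
  also have "\<dots> \<le> A * (\<Sum>x\<in>(box (Suc n) :: (int ^ 'd) set). \<Sum>i\<in>(UNIV :: 'd set). 81 * K / t n * E x)"
    by (intro mult_left_mono sum_mono local_bound) (auto simp: A_def)
  also have "\<dots> = A * (81 * CARD('d) * (K / t n)) * (\<Sum>x\<in>box (Suc n). E x)"
    unfolding sum_distrib_left by (rule sum.cong) (simp_all add: mult_ac)
  also have "\<dots> \<le> A * (81 * CARD('d) * (K / t n)) * (2 * 7 ^ CARD('d) * energy w f)"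
  proof (rule mult_left_mono)
    show "(\<Sum>x\<in>box (Suc n). E x) \<le> 2 * 7 ^ CARD('d) * energy w f"
      unfolding E_def by (rule sum_pairs_le_energy[OF w supp]) auto
    \<comment> \<open>Nonnegativity of \<open>K\<close> is not assumed; it follows from
      \<open>U\<close> at \<open>r = n\<close>.\<close>
    have "0 \<le> (real n)\<^sup>2 * t n" using t[of n] by simp
    also have "\<dots> \<le> (K * t n) * (real n + 1)\<^sup>2" using U[of n] by (simp add: mult_ac)
    finally have "K * t n \<ge> 0" by (simp add: zero_le_mult_iff)
    then have "K \<ge> 0" using t[of n] by (simp add: zero_le_mult_iff)
    then show "0 \<le> A * (81 * CARD('d) * (K / t n))" using t[of n] by (simp add: A_def)
  qed
  finally show ?thesis using t[of n] unfolding A_def[symmetric] by (simp add: field_simps)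
qed

section \<open>Dyadic sums and variances of locally dependent sums\<close>

lemma power_Suc_diff_le: "(real m + 1) ^ d - real m ^ d \<le> real d * (real m + 1) ^ (d - 1)"
proof (induction d)
  case (Suc d)
  have "(real m + 1) ^ Suc d - real m ^ Suc d = (real m + 1) * ((real m + 1) ^ d - real m ^ d) + real m ^ d"
    by (simp add: algebra_simps)
  also have "\<dots> \<le> (real m + 1) * (real d * (real m + 1) ^ (d - 1)) + (real m + 1) ^ d"
    by (intro add_mono mult_left_mono Suc.IH power_mono) auto
  also have "\<dots> = real (Suc d) * (real m + 1) ^ (Suc d - 1)"
    by (cases d) (auto simp: algebra_simps)
  finally show ?case .
qed simp

lemma summable_of_partial_sums_le:
  fixes f g :: "nat \<Rightarrow> real"
  assumes "summable g" "\<And>n. 0 \<le> f n" "\<And>n. 0 \<le> g n" "\<And>n. (\<Sum>k<n. f k) \<le> C * (\<Sum>k<h n. g k)" "0 \<le> C"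
  shows "summable f"
proof (rule summableI_nonneg_bounded[where x = "C * suminf g"])
  show "(\<Sum>k<n. f k) \<le> C * suminf g" for n
    using assms by (intro order_trans[OF assms(4)] mult_left_mono sum_le_suminf) auto
qed (use assms in auto)

lemma sum_lessThan_double:
  fixes b :: "nat \<Rightarrow> real"
  shows "(\<Sum>m<2 ^ Suc n. b m) = (\<Sum>m<2 ^ n. b m) + (\<Sum>m\<in>{2 ^ n..<2 ^ Suc n}. b m)"
  using sum.atLeastLessThan_concat[of 0 "2 ^ n" "2 ^ Suc n" b] by (simp add: lessThan_atLeast0)

text \<open>The general term is not monotone, so Cauchy condensation does not apply directly.\<close>

lemma summable_condensed:
  fixes a :: "nat \<Rightarrow> real"
  assumes a: "antimono a" "\<And>m. 0 \<le> a m" and d: "d \<ge> 1" and sum: "summable (\<lambda>m. (real m + 1) ^ (d - 1) * a m)"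
  shows "summable (\<lambda>k. (2 ^ k) ^ d * a (2 ^ k))"
proof -
  let ?b = "\<lambda>m. (real m + 1) ^ (d - 1) * a m"
  \<comment> \<open>The term at \<open>2 ^ Suc n\<close> is compared with the block just before it:
    there \<open>a\<close> is at least \<open>a (2 ^ Suc n)\<close> and \<open>m + 1\<close> at
    least \<open>2 ^ n\<close>, and the block has \<open>2 ^ n\<close> members. Enlarging the
    argument from \<open>2 ^ n\<close> to \<open>2 ^ Suc n\<close> costs
    \<open>2 ^ d\<close>.\<close>
  have "(\<Sum>k<n. (2 ^ Suc k) ^ d * a (2 ^ Suc k)) \<le> 2 ^ d * (\<Sum>m<2 ^ n. ?b m)" for n
  proof (induction n)
    case (Suc n)
    have "(2 ^ n) ^ d * a (2 ^ Suc n) = (\<Sum>m\<in>{2 ^ n..<2 ^ Suc n :: nat}. (2 ^ n) ^ (d - 1) * a (2 ^ Suc n))"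
      using d by (cases d) auto
    also have "\<dots> \<le> (\<Sum>m\<in>{2 ^ n..<2 ^ Suc n}. ?b m)"
    proof (intro sum_mono mult_mono power_mono a antimonoD[OF a(1)])
      fix m :: nat assume "m \<in> {2 ^ n..<2 ^ Suc n}"
      then have "2 ^ n \<le> m" by simp
      then have "real (2 ^ n) \<le> real m" by (simp only: of_nat_le_iff)
      then have "2 ^ n \<le> real m" by (simp only: of_nat_power of_nat_numeral)
      then show "2 ^ n \<le> real m + 1" by linarith
    qed auto
    finally have "2 ^ d * ((2 ^ n) ^ d * a (2 ^ Suc n)) \<le> 2 ^ d * (\<Sum>m\<in>{2 ^ n..<2 ^ Suc n}. ?b m)"
      by (intro mult_left_mono) auto
    moreover have "(2 ^ Suc n) ^ d * a (2 ^ Suc n) = 2 ^ d * ((2 ^ n) ^ d * a (2 ^ Suc n))"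
      by (simp add: power_mult_distrib)
    ultimately show ?case using Suc.IH by (simp only: sum_lessThan_double sum.lessThan_Suc distrib_left)
  qed (use a in auto)
  then have "summable (\<lambda>k. (2 ^ Suc k) ^ d * a (2 ^ Suc k))"
    using a by (intro summable_of_partial_sums_le[OF sum, where C = "2 ^ d" and h = "\<lambda>n. 2 ^ n"]) auto
  then show ?thesis by (subst (asm) summable_Suc_iff)
qed

text \<open>Passing to the next scale at least halves the old part of the normalised sum and adds at
  most one dyadic block of \<open>b\<close>. Iterating bounds the sum over all scales by twice the
  sum of \<open>b\<close>. This serves to sum the Chebyshev bounds.\<close>

lemma summable_dyadic_truncation:
  fixes b :: "nat \<Rightarrow> real"
  assumes b: "\<And>m. 0 \<le> b m" and d: "d \<ge> 1" and sum: "summable b"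
  shows "summable (\<lambda>k. (\<Sum>m<2 ^ k. (real m + 1) ^ d * b m) / (2 ^ k) ^ d)"
proof -
  define T where "T k = (\<Sum>m<2 ^ k. (real m + 1) ^ d * b m) / (2 ^ k) ^ d" for k
  have T0: "T k \<ge> 0" for k by (auto simp: T_def b intro!: divide_nonneg_nonneg sum_nonneg)
  have step: "T (Suc n) \<le> T n / 2 + (\<Sum>m\<in>{2 ^ n..<2 ^ Suc n}. b m)" for n
  proof -
    have "T (Suc n) = T n / 2 ^ d + (\<Sum>m\<in>{2 ^ n..<2 ^ Suc n}. ((real m + 1) / 2 ^ Suc n) ^ d * b m)"
      unfolding T_def sum_lessThan_double
      by (simp add: add_divide_distrib[of "sum _ _"] sum_divide_distrib power_divide power_mult_distrib mult_ac)
    also have "\<dots> \<le> T n / 2 + (\<Sum>m\<in>{2 ^ n..<2 ^ Suc n}. 1 * b m)"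
    proof (intro add_mono sum_mono mult_right_mono b)
      have "(2::real) ^ 1 \<le> 2 ^ d" using d by (intro power_increasing) auto
      then show "T n / 2 ^ d \<le> T n / 2" using T0 by (intro divide_left_mono) auto
      fix m :: nat assume "m \<in> {2 ^ n..<2 ^ Suc n}"
      then have "Suc m \<le> 2 ^ Suc n" by simp
      then have "real (Suc m) \<le> real (2 ^ Suc n)" by (simp only: of_nat_le_iff)
      then have "(real m + 1) / 2 ^ Suc n \<le> 1" unfolding of_nat_power by (simp add: algebra_simps)
      then show "((real m + 1) / 2 ^ Suc n) ^ d \<le> 1" by (intro power_le_one) auto
    qed
    finally show ?thesis by simp
  qed
  \<comment> \<open>The additional \<open>T n\<close> absorbs the halved term of the recursion,
    closing the induction with the factor 2.\<close>
  have "(\<Sum>k<Suc n. T k) + T n \<le> 2 * (\<Sum>m<2 ^ n. b m)" for n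
  proof (induction n)
    case 0
    then show ?case by (simp add: T_def)
  next
    case (Suc n)
    then show ?case using step[of n] by (simp only: sum_lessThan_double sum.lessThan_Suc distrib_left)
  qed
  then have "(\<Sum>k<n. T k) \<le> 2 * (\<Sum>m<2 ^ n. b m)" for n
    using T0[of n] by (smt (verit) sum.lessThan_Suc)
  then have "summable T"
    using T0 b by (intro summable_of_partial_sums_le[OF sum, where C = 2 and h = "\<lambda>n. 2 ^ n"]) auto
  then show ?thesis by (simp add: T_def[abs_def])
qed

section \<open>Variance of locally dependent sums\<close>

context prob_space begin

text \<open>Only pairs with \<open>y \<in> N x\<close> contribute covariance, at most
  \<open>D\<close> for each \<open>x\<close>. Such a covariance is at most \<open>v\<close>: the
  mean of the product is bounded by the average of the second moments, and the product of the means
  is nonnegative. The bound \<open>C\<close> supplies integrability.\<close>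

lemma variance_sum_local:
  fixes Z :: "'i \<Rightarrow> 'a \<Rightarrow> real"
  assumes X: "finite X" and meas: "\<And>x. x \<in> X \<Longrightarrow> random_variable borel (Z x)"
    and bdd: "\<And>x \<omega>. x \<in> X \<Longrightarrow> \<bar>Z x \<omega>\<bar> \<le> C"
    and v: "\<And>x. x \<in> X \<Longrightarrow> expectation (\<lambda>\<omega>. (Z x \<omega>)\<^sup>2) \<le> v"
    and uncorr: "\<And>x y. x \<in> X \<Longrightarrow> y \<in> X \<Longrightarrow> y \<notin> N x \<Longrightarrow>
      expectation (\<lambda>\<omega>. Z x \<omega> * Z y \<omega>) = expectation (Z x) * expectation (Z y)"
    and N: "\<And>x. x \<in> X \<Longrightarrow> card (X \<inter> N x) \<le> D" and nonneg: "\<And>x \<omega>. x \<in> X \<Longrightarrow> 0 \<le> Z x \<omega>"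
  shows "variance (\<lambda>\<omega>. \<Sum>x\<in>X. Z x \<omega>) \<le> real (card X) * real D * v"
proof -
  have int: "integrable M (Z x)" if "x \<in> X" for x
    using meas bdd that by (intro integrable_const_bound[of _ C]) auto
  have bdd2: "\<bar>Z x \<omega> * Z y \<omega>\<bar> \<le> C * C" if "x \<in> X" "y \<in> X" for x y \<omega>
    unfolding abs_mult using bdd[of x \<omega>] bdd[of y \<omega>] that by (intro mult_mono) auto
  have int2: "integrable M (\<lambda>\<omega>. Z x \<omega> * Z y \<omega>)" if "x \<in> X" "y \<in> X" for x y
    using meas bdd2 that by (intro integrable_const_bound[of _ "C * C"]) auto
  have sq: "(\<Sum>x\<in>X. Z x \<omega>)\<^sup>2 = (\<Sum>x\<in>X. \<Sum>y\<in>X. Z x \<omega> * Z y \<omega>)" for \<omega>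
    by (simp add: power2_eq_square sum_product)
  have "variance (\<lambda>\<omega>. \<Sum>x\<in>X. Z x \<omega>)
    = expectation (\<lambda>\<omega>. (\<Sum>x\<in>X. Z x \<omega>)\<^sup>2) - (expectation (\<lambda>\<omega>. \<Sum>x\<in>X. Z x \<omega>))\<^sup>2"
    using int int2 by (intro variance_eq) (auto simp: sq)
  also have "\<dots> = (\<Sum>x\<in>X. \<Sum>y\<in>X. expectation (\<lambda>\<omega>. Z x \<omega> * Z y \<omega>) - expectation (Z x) * expectation (Z y))"
    unfolding sq using int int2
    by (simp add: power2_eq_square sum_product sum_subtractf)
  also have "\<dots> \<le> (\<Sum>x\<in>X. \<Sum>y\<in>X. if y \<in> N x then v else 0)"
  proof (intro sum_mono)
    fix x y assume x: "x \<in> X" and y: "y \<in> X"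
    show "expectation (\<lambda>\<omega>. Z x \<omega> * Z y \<omega>) - expectation (Z x) * expectation (Z y) \<le> (if y \<in> N x then v else 0)"
    proof (cases "y \<in> N x")
      case True
      have "expectation (\<lambda>\<omega>. Z x \<omega> * Z y \<omega>) \<le> expectation (\<lambda>\<omega>. ((Z x \<omega>)\<^sup>2 + (Z y \<omega>)\<^sup>2) / 2)"
      proof (intro integral_mono)
        show "Z x \<omega> * Z y \<omega> \<le> ((Z x \<omega>)\<^sup>2 + (Z y \<omega>)\<^sup>2) / 2" for \<omega>
          using sum_squares_bound[of "Z x \<omega>" "Z y \<omega>"] by simp
      qed (use int2 x y in \<open>auto simp: power2_eq_square\<close>)
      also have "\<dots> = (expectation (\<lambda>\<omega>. (Z x \<omega>)\<^sup>2) + expectation (\<lambda>\<omega>. (Z y \<omega>)\<^sup>2)) / 2"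
        using int2[OF x x] int2[OF y y] by (simp add: power2_eq_square)
      also have "\<dots> \<le> v" using v[OF x] v[OF y] by simp
      finally have "expectation (\<lambda>\<omega>. Z x \<omega> * Z y \<omega>) \<le> v" .
      moreover have "0 \<le> expectation (Z x) * expectation (Z y)"
        using nonneg x y by (intro mult_nonneg_nonneg integral_nonneg) auto
      ultimately show ?thesis using True by simp
    qed (use uncorr x y in auto)
  qed
  also have "\<dots> = (\<Sum>x\<in>X. real (card (X \<inter> N x)) * v)"
    using X by (simp add: sum.If_cases)
  also have "\<dots> \<le> (\<Sum>x\<in>X. real D * v)"
  proof (intro sum_mono mult_right_mono)
    fix x assume x: "x \<in> X"
    show "real (card (X \<inter> N x)) \<le> real D" using N[OF x] by simp
    have "0 \<le> expectation (\<lambda>\<omega>. (Z x \<omega>)\<^sup>2)" by simp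
    also have "\<dots> \<le> v" by (rule v[OF x])
    finally show "0 \<le> v" .
  qed
  finally show ?thesis by simp
qed

end

section \<open>The lower bound\<close>

text \<open>The negation is the hypothesis of \<open>good_route\<close> at level
  \<open>t m\<close>.\<close>

definition crowded :: "(nat \<Rightarrow> real) \<Rightarrow> int ^ 'd \<Rightarrow> nat \<Rightarrow> ((int ^ 'd) set \<Rightarrow> real) \<Rightarrow> bool" where
  "crowded t x m v \<longleftrightarrow> 2 * CARD('d) \<le> card {e \<in> nbhd x. v e \<le> t m}"

text \<open>The cap \<open>N\<close> makes the minimum exist and all moments finite.\<close>

definition scale :: "(nat \<Rightarrow> real) \<Rightarrow> nat \<Rightarrow> int ^ 'd \<Rightarrow> ((int ^ 'd) set \<Rightarrow> real) \<Rightarrow> nat" where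
  "scale t N x v = (LEAST m. N \<le> m \<or> \<not> crowded t x m v)"

lemma crowded_antimono:
  fixes x :: "int ^ 'd::finite"
  assumes "antimono t" "m \<le> m'" "crowded t x m' v"
  shows "crowded t x m v"
proof -
  have "t m' \<le> t m" using assms(1,2) by (rule antimonoD)
  then have "card {e \<in> nbhd x. v e \<le> t m'} \<le> card {e \<in> nbhd x. v e \<le> t m}"
    by (intro card_mono) (auto simp: finite_nbhd)
  then show ?thesis using assms(3) by (simp add: crowded_def)
qed

lemma scale_le: "scale t N x v \<le> N"
  unfolding scale_def by (rule Least_le) simp

text \<open>If the cap itself is a good level, the minimum is a good level too, even when it equals
  the cap.\<close>

lemma not_crowded_scale: "\<not> crowded t x N v \<Longrightarrow> \<not> crowded t x (scale t N x v) v"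
  unfolding scale_def
  by (smt (verit, best) LeastI_ex Least_le le_antisym order_refl)

lemma crowded_iff_less_scale:
  fixes x :: "int ^ 'd::finite"
  assumes "antimono t" "m < N"
  shows "crowded t x m v \<longleftrightarrow> m < scale t N x v"
proof
  assume m: "m < scale t N x v"
  then show "crowded t x m v" unfolding scale_def using not_less_Least by fastforce
next
  assume m: "crowded t x m v"
  show "m < scale t N x v"
  proof (rule ccontr)
    assume "\<not> m < scale t N x v"
    then have le: "scale t N x v \<le> m" by simp
    have "N \<le> scale t N x v \<or> \<not> crowded t x (scale t N x v) v"
      unfolding scale_def by (rule LeastI[of _ N]) simp
    then show False using le assms crowded_antimono[OF assms(1) le m] by auto
  qed
qed

text \<open>Layer-cake formula: by monotonicity in the level, the crowded levels below
  \<open>N\<close> are those below the scale, and the increments telescope. Moments and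
  measurability of the scale thus reduce to those of crowding events. With \<open>k \<ge> 1\<close>
  the telescoped value at 0 vanishes.\<close>

lemma scale_power_eq_sum:
  fixes x :: "int ^ 'd::finite"
  assumes "antimono t" "k \<ge> 1"
  shows "real (scale t N x v) ^ k = (\<Sum>m<N. ((real m + 1) ^ k - real m ^ k) * of_bool (crowded t x m v))"
proof -
  have "(\<Sum>m<N. ((real m + 1) ^ k - real m ^ k) * of_bool (crowded t x m v))
    = (\<Sum>m<N. if m \<in> {..<scale t N x v} then (real m + 1) ^ k - real m ^ k else 0)"
    by (intro sum.cong) (auto simp: crowded_iff_less_scale[OF assms(1)])
  also have "\<dots> = (\<Sum>m\<in>{..<N} \<inter> {..<scale t N x v}. real (Suc m) ^ k - real m ^ k)"
    by (subst sum.inter_restrict[symmetric]) (auto simp: add.commute)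
  also have "{..<N} \<inter> {..<scale t N x v} = {..<scale t N x v}" using scale_le[of t N x v] by auto
  also have "(\<Sum>m<scale t N x v. real (Suc m) ^ k - real m ^ k) = real (scale t N x v) ^ k - real 0 ^ k"
    by (rule sum_lessThan_telescope)
  finally show ?thesis using assms(2) by simp
qed

lemma crowded_restrict: "crowded t x m (restrict v (nbhd x)) = crowded t x m v"
  by (simp add: crowded_def cong: conj_cong)

text \<open>Locality: the scale at \<open>x\<close> is a function of the conductances in
  \<open>nbhd x\<close>, the source of independence between distant sites.\<close>

lemma scale_restrict: "scale t N x (restrict v (nbhd x)) = scale t N x v"
  by (simp add: scale_def crowded_restrict)

lemma measurable_card_le:
  assumes "finite K" "\<And>e. e \<in> K \<Longrightarrow> X e \<in> borel_measurable N"
  shows "Measurable.pred N (\<lambda>v. k \<le> card {e \<in> K. X e v \<le> (s :: real)})"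
proof -
  have [measurable]: "(\<lambda>v. indicator {..s} (X e v) :: real) \<in> borel_measurable N" if "e \<in> K" for e
    using assms(2)[OF that] by measurable
  have *: "(\<lambda>v. \<Sum>e\<in>K. indicator {..s} (X e v) :: real) \<in> borel_measurable N"
    by (intro borel_measurable_sum) measurable
  have eq: "real (card {e \<in> K. X e v \<le> s}) = (\<Sum>e\<in>K. indicator {..s} (X e v))" for v
    using assms(1) by (simp add: indicator_def sum.If_cases Int_def)
  have "Measurable.pred N (\<lambda>v. real k \<le> (\<Sum>e\<in>K. indicator {..s} (X e v)))"
    using * by measurable
  then show ?thesis by (simp add: eq[symmetric])
qed

lemma nbhd_subset_edges: "nbhd x \<subseteq> edges" by (auto simp: nbhd_def)

lemma nbhd_disjoint:
  fixes x y :: "int ^ 'd::finite"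
  assumes "\<not> (\<forall>i. \<bar>y $ i - x $ i\<bar> \<le> 6)"
  shows "nbhd x \<inter> nbhd y = {}"
proof (rule ccontr)
  assume "nbhd x \<inter> nbhd y \<noteq> {}"
  then obtain e where e: "e \<in> nbhd x" "e \<in> nbhd y" by blast
  then obtain a where "a \<in> e" by (auto simp: nbhd_def edges_def)
  then have near: "\<bar>a $ i - x $ i\<bar> \<le> 3" "\<bar>a $ i - y $ i\<bar> \<le> 3" for i using e by (auto simp: nbhd_def)
  have "\<bar>y $ i - x $ i\<bar> \<le> 6" for i using near[of i] by arith
  then show False using assms by blast
qed

text \<open>A crude count by ordered pairs of sites in the cube; what matters is uniformity in
  \<open>x\<close>.\<close>

lemma card_nbhd: "card (nbhd (x :: int ^ 'd::finite)) \<le> (7 ^ CARD('d))\<^sup>2"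
proof -
  let ?Q = "{y. \<forall>i. \<bar>y $ i - x $ i\<bar> \<le> 3}"
  have "card (nbhd x) \<le> card (pairs x)"
    unfolding nbhd_eq_pairs by (intro card_image_le finite_pairs)
  also have "\<dots> \<le> card (?Q \<times> ?Q)"
    using finite_cube by (intro card_mono finite_cartesian_product) (auto simp: pairs_def nbhd_def)
  also have "\<dots> = (7 ^ CARD('d))\<^sup>2" by (simp add: card_cartesian_product card_cube power2_eq_square)
  finally show ?thesis .
qed

section \<open>Crowding probabilities and moments of the local scales\<close>

locale iid_conductances = prob_space M for M :: "'w measure" +
  fixes W :: "(int ^ 'd::finite) set \<Rightarrow> 'w \<Rightarrow> real" and mu :: "real measure"
  assumes dim: "CARD('d) \<ge> 2"
    and indep: "indep_vars (\<lambda>_. borel) W edges"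
    and law: "e \<in> edges \<Longrightarrow> distr M borel (W e) = mu"
    and pos: "e \<in> edges \<Longrightarrow> AE \<omega> in M. W e \<omega> > 0"
begin

definition p :: "real \<Rightarrow> real" where "p s = measure mu {..s}"

abbreviation env :: "'w \<Rightarrow> (int ^ 'd) set \<Rightarrow> real" where "env \<omega> \<equiv> \<lambda>e. W e \<omega>"

lemma W_measurable [measurable]: "e \<in> edges \<Longrightarrow> W e \<in> borel_measurable M"
  using indep unfolding indep_vars_def by auto

lemma prob_le: "e \<in> edges \<Longrightarrow> prob {\<omega> \<in> space M. W e \<omega> \<le> s} = p s"
proof -
  assume e: "e \<in> edges"
  have "p s = measure (distr M borel (W e)) {..s}" by (simp add: p_def law[OF e])
  also have "\<dots> = prob (W e -` {..s} \<inter> space M)" using e by (intro measure_distr) auto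
  also have "W e -` {..s} \<inter> space M = {\<omega> \<in> space M. W e \<omega> \<le> s}" by auto
  finally show ?thesis by simp
qed

lemma edge_exists: "\<exists>e :: (int ^ 'd) set. e \<in> edges"
  using adj_add_basis(1)[of "0 :: int ^ 'd"] by (auto simp: edges_def)

text \<open>\<open>mu\<close> is accessible only as the law of an edge, so an edge is exhibited
  first.\<close>

lemma p_bounds: "0 \<le> p s" "p s \<le> 1"
proof -
  obtain e :: "(int ^ 'd) set" where "e \<in> edges" using edge_exists by blast
  then show "0 \<le> p s" "p s \<le> 1" unfolding prob_le[OF \<open>e \<in> edges\<close>, symmetric] by auto
qed

lemma p_mono: "s \<le> s' \<Longrightarrow> p s \<le> p s'"
proof -
  obtain e :: "(int ^ 'd) set" where [measurable]: "e \<in> edges" using edge_exists by blast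
  assume "s \<le> s'"
  then show ?thesis unfolding prob_le[OF \<open>e \<in> edges\<close>, symmetric]
    by (intro finite_measure_mono) auto
qed

lemma prob_all_le:
  assumes "finite S" "S \<subseteq> edges"
  shows "prob {\<omega> \<in> space M. \<forall>e\<in>S. W e \<omega> \<le> s} = p s ^ card S"
proof (cases "S = {}")
  case True
  then show ?thesis by (simp add: prob_space)
next
  case False
  have "{\<omega> \<in> space M. \<forall>e\<in>S. W e \<omega> \<le> s} = (\<Inter>e\<in>S. W e -` {..s} \<inter> space M)"
    using False by auto
  also have "prob \<dots> = (\<Prod>e\<in>S. prob (W e -` {..s} \<inter> space M))"
    by (rule indep_varsD[OF indep False assms]) auto
  also have "\<dots> = (\<Prod>e\<in>S. p s)"
    using assms(2) by (intro prod.cong refl, subst prob_le[symmetric]) (auto intro!: arg_cong[where f = prob])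
  finally show ?thesis by simp
qed

lemma crowded_measurable [measurable]: "Measurable.pred M (\<lambda>\<omega>. crowded t x m (env \<omega>))"
  unfolding crowded_def using nbhd_subset_edges
  by (intro measurable_card_le finite_nbhd W_measurable) auto

text \<open>Union bound over the subsets of \<open>nbhd x\<close> of size
  \<open>2 * CARD('d)\<close>; the constant bounds the number of all subsets.\<close>

lemma prob_crowded:
  "prob {\<omega> \<in> space M. crowded t x m (env \<omega>)} \<le> 2 ^ (7 ^ CARD('d))\<^sup>2 * p (t m) ^ (2 * CARD('d))"
proof -
  define \<S> where "\<S> = {S. S \<subseteq> nbhd x \<and> card S = 2 * CARD('d)}"
  have fin: "finite \<S>" "card \<S> \<le> 2 ^ (7 ^ CARD('d))\<^sup>2"
  proof -
    have "\<S> \<subseteq> Pow (nbhd x)" by (auto simp: \<S>_def)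
    moreover have "finite (Pow (nbhd x))" by (simp add: finite_nbhd)
    ultimately show "finite \<S>" "card \<S> \<le> 2 ^ (7 ^ CARD('d))\<^sup>2"
      using card_mono[of "Pow (nbhd x)" \<S>] card_nbhd[of x]
      by (auto intro: finite_subset simp: card_Pow finite_nbhd elim!: order_trans)
  qed
  have meas: "{\<omega> \<in> space M. \<forall>e\<in>S. W e \<omega> \<le> t m} \<in> events" if "S \<in> \<S>" for S
  proof -
    have "S \<subseteq> nbhd x" using that by (simp add: \<S>_def)
    then have "finite S" "S \<subseteq> edges"
      using finite_subset[OF _ finite_nbhd] nbhd_subset_edges by blast+
    then show ?thesis by (intro sets.sets_Collect_finite_All) auto
  qed
  have "prob {\<omega> \<in> space M. crowded t x m (env \<omega>)} \<le> prob (\<Union>S\<in>\<S>. {\<omega> \<in> space M. \<forall>e\<in>S. W e \<omega> \<le> t m})"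
  proof (rule finite_measure_mono)
    show "{\<omega> \<in> space M. crowded t x m (env \<omega>)} \<subseteq> (\<Union>S\<in>\<S>. {\<omega> \<in> space M. \<forall>e\<in>S. W e \<omega> \<le> t m})"
    proof
      fix \<omega> assume \<omega>: "\<omega> \<in> {\<omega> \<in> space M. crowded t x m (env \<omega>)}"
      then obtain S where "S \<subseteq> {e \<in> nbhd x. W e \<omega> \<le> t m}" "card S = 2 * CARD('d)"
        unfolding crowded_def by (auto elim: obtain_subset_with_card_n)
      then show "\<omega> \<in> (\<Union>S\<in>\<S>. {\<omega> \<in> space M. \<forall>e\<in>S. W e \<omega> \<le> t m})"
        using \<omega> by (auto simp: \<S>_def intro!: exI[of _ S])
    qed
    show "(\<Union>S\<in>\<S>. {\<omega> \<in> space M. \<forall>e\<in>S. W e \<omega> \<le> t m}) \<in> events"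
      using fin meas by (intro sets.finite_UN) auto
  qed
  also have "\<dots> \<le> (\<Sum>S\<in>\<S>. prob {\<omega> \<in> space M. \<forall>e\<in>S. W e \<omega> \<le> t m})"
    using fin meas by (intro finite_measure_subadditive_finite) auto
  also have "\<dots> = (\<Sum>S\<in>\<S>. p (t m) ^ (2 * CARD('d)))"
  proof (intro sum.cong refl)
    fix S assume S: "S \<in> \<S>"
    then have "S \<subseteq> nbhd x" by (simp add: \<S>_def)
    then have "finite S" "S \<subseteq> edges"
      using finite_subset[OF _ finite_nbhd] nbhd_subset_edges by blast+
    then show "prob {\<omega> \<in> space M. \<forall>e\<in>S. W e \<omega> \<le> t m} = p (t m) ^ (2 * CARD('d))"
      using S by (simp add: prob_all_le \<S>_def)
  qed
  also have "\<dots> = real (card \<S>) * p (t m) ^ (2 * CARD('d))" by simp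
  also have "\<dots> \<le> real (2 ^ (7 ^ CARD('d))\<^sup>2) * p (t m) ^ (2 * CARD('d))"
    using fin(2) p_bounds(1) by (intro mult_right_mono) (simp_all only: of_nat_le_iff zero_le_power)
  finally show ?thesis by simp
qed

text \<open>Expectation of the layer-cake formula, with \<open>(m + 1) ^ k - m ^ k\<close> bounded
  by the discrete derivative and each crowding event by \<open>prob_crowded\<close>.\<close>

lemma expectation_scale_power:
  assumes t: "antimono t" and k: "k \<ge> 1"
  shows "expectation (\<lambda>\<omega>. real (scale t N x (env \<omega>)) ^ k)
    \<le> 2 ^ (7 ^ CARD('d))\<^sup>2 * (\<Sum>m<N. real k * (real m + 1) ^ (k - 1) * p (t m) ^ (2 * CARD('d)))"
proof -
  define c where "c m = (real m + 1) ^ k - real m ^ k" for m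
  have c0: "c m \<ge> 0" for m by (simp add: c_def power_mono)
  have int: "integrable M (\<lambda>\<omega>. of_bool (crowded t x m (env \<omega>)) :: real)" for m
    by (intro integrable_const_bound[of _ 1]) auto
  have "expectation (\<lambda>\<omega>. real (scale t N x (env \<omega>)) ^ k)
    = (\<Sum>m<N. c m * expectation (\<lambda>\<omega>. of_bool (crowded t x m (env \<omega>))))"
    unfolding scale_power_eq_sum[OF t k] c_def[symmetric]
    by (subst Bochner_Integration.integral_sum, rule integrable_mult_right, rule int)
      (simp only: integral_mult_right_zero)
  also have "\<dots> = (\<Sum>m<N. c m * prob {\<omega> \<in> space M. crowded t x m (env \<omega>)})"
  proof (intro sum.cong refl arg_cong2[where f = "(*)"])
    fix m
    have "expectation (\<lambda>\<omega>. of_bool (crowded t x m (env \<omega>))) = expectation (indicator {\<omega> \<in> space M. crowded t x m (env \<omega>)})"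
      by (intro Bochner_Integration.integral_cong) (auto simp: indicator_def)
    also have "\<dots> = prob ({\<omega> \<in> space M. crowded t x m (env \<omega>)} \<inter> space M)" by (rule Bochner_Integration.integral_indicator)
    also have "{\<omega> \<in> space M. crowded t x m (env \<omega>)} \<inter> space M = {\<omega> \<in> space M. crowded t x m (env \<omega>)}" by auto
    finally show "expectation (\<lambda>\<omega>. of_bool (crowded t x m (env \<omega>))) = prob {\<omega> \<in> space M. crowded t x m (env \<omega>)}" .
  qed
  also have "\<dots> \<le> (\<Sum>m<N. (real k * (real m + 1) ^ (k - 1)) * (2 ^ (7 ^ CARD('d))\<^sup>2 * p (t m) ^ (2 * CARD('d))))"
    by (intro sum_mono mult_mono prob_crowded) (simp_all only: c_def power_Suc_diff_le, auto)
  finally show ?thesis by (simp add: sum_distrib_left mult_ac)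
qed

text \<open>Both scales are measurable functions of disjoint, hence independent, families of
  conductances.\<close>

lemma scale_uncorrelated:
  assumes t: "antimono t" and xy: "nbhd x \<inter> nbhd y = {}" and k: "k \<ge> 1"
  shows "expectation (\<lambda>\<omega>. real (scale t N x (env \<omega>)) ^ k * real (scale t N y (env \<omega>)) ^ k)
    = expectation (\<lambda>\<omega>. real (scale t N x (env \<omega>)) ^ k) * expectation (\<lambda>\<omega>. real (scale t N y (env \<omega>)) ^ k)"
proof -
  define Y where "Y z v = real (scale t N z v) ^ k" for z :: "int ^ 'd" and v
  have Ym: "Y z \<in> borel_measurable (PiM (nbhd z) (\<lambda>_. borel))" for z
  proof -
    have [measurable]: "Measurable.pred (PiM (nbhd z) (\<lambda>_. borel)) (crowded t z m)" for m
      unfolding crowded_def by (intro measurable_card_le finite_nbhd measurable_component_singleton)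
    show ?thesis unfolding Y_def scale_power_eq_sum[OF t k] by measurable
  qed
  have restr: "(Y z \<circ> (\<lambda>\<omega>. restrict (env \<omega>) (nbhd z))) = (\<lambda>\<omega>. Y z (env \<omega>))" for z
    by (simp add: fun_eq_iff Y_def scale_restrict)
  have ind: "indep_var borel (\<lambda>\<omega>. Y x (env \<omega>)) borel (\<lambda>\<omega>. Y y (env \<omega>))"
    using indep_var_compose[OF indep_var_restrict[OF indep xy nbhd_subset_edges nbhd_subset_edges] Ym Ym]
    unfolding restr .
  have int: "integrable M (\<lambda>\<omega>. Y z (env \<omega>))" if "(\<lambda>\<omega>. Y z (env \<omega>)) \<in> borel_measurable M" for z
    using that scale_le[of t N z] by (intro integrable_const_bound[of _ "real N ^ k"]) (auto simp: Y_def power_mono)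
  show ?thesis
    using indep_var_lebesgue_integral[OF ind int int] indep_var_rv1[OF ind] indep_var_rv2[OF ind]
    by (simp add: Y_def)
qed

lemma scale_power_measurable:
  assumes "antimono t" "k \<ge> 1"
  shows "(\<lambda>\<omega>. real (scale t N x (env \<omega>)) ^ k) \<in> borel_measurable M"
  unfolding scale_power_eq_sum[OF assms] by measurable

text \<open>At most \<open>13 ^ CARD('d)\<close> sites lie within sup-distance 6 of a given one. The
  second moment of the \<open>d\<close>-th power is the \<open>2d\<close>-th moment of the scale,
  which explains the exponent \<open>2 * CARD('d) - 1\<close>.\<close>

lemma variance_sum_scale:
  assumes t: "antimono t"
  shows "variance (\<lambda>\<omega>. \<Sum>x\<in>box L. real (scale t N x (env \<omega>)) ^ CARD('d))
    \<le> real ((2 * L + 1) ^ CARD('d)) * real (13 ^ CARD('d)) * (2 ^ (7 ^ CARD('d))\<^sup>2 *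
      (\<Sum>m<N. real (2 * CARD('d)) * (real m + 1) ^ (2 * CARD('d) - 1) * p (t m) ^ (2 * CARD('d))))"
  unfolding card_box[where 'd = 'd, symmetric]
proof (rule variance_sum_local[where C = "real N ^ CARD('d)" and N = "\<lambda>x. {y. \<forall>i. \<bar>y $ i - x $ i\<bar> \<le> 6}"])
  have d: "CARD('d) \<ge> 1" using dim by simp
  show "random_variable borel (\<lambda>\<omega>. real (scale t N x (env \<omega>)) ^ CARD('d))" for x
    by (rule scale_power_measurable[OF t d])
  show "\<bar>real (scale t N x (env \<omega>)) ^ CARD('d)\<bar> \<le> real N ^ CARD('d)" for x \<omega>
    using scale_le by (simp add: power_mono)
  show "expectation (\<lambda>\<omega>. (real (scale t N x (env \<omega>)) ^ CARD('d))\<^sup>2) \<le> 2 ^ (7 ^ CARD('d))\<^sup>2 *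
      (\<Sum>m<N. real (2 * CARD('d)) * (real m + 1) ^ (2 * CARD('d) - 1) * p (t m) ^ (2 * CARD('d)))" for x
    using expectation_scale_power[OF t, of "2 * CARD('d)" N x] d
    by (simp add: power_mult[symmetric] mult.commute[of _ 2])
  show "expectation (\<lambda>\<omega>. real (scale t N x (env \<omega>)) ^ CARD('d) * real (scale t N y (env \<omega>)) ^ CARD('d)) =
     expectation (\<lambda>\<omega>. real (scale t N x (env \<omega>)) ^ CARD('d)) * expectation (\<lambda>\<omega>. real (scale t N y (env \<omega>)) ^ CARD('d))"
    if "y \<notin> {y. \<forall>i. \<bar>y $ i - x $ i\<bar> \<le> 6}" for x y
    using that d by (intro scale_uncorrelated[OF t nbhd_disjoint]) auto
  show "card (box L \<inter> {y. \<forall>i. \<bar>y $ i - x $ i\<bar> \<le> 6}) \<le> 13 ^ CARD('d)" for x :: "int ^ 'd"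
  proof -
    have "card (box L \<inter> {y. \<forall>i. \<bar>y $ i - x $ i\<bar> \<le> 6}) \<le> card {y. \<forall>i. \<bar>y $ i - x $ i\<bar> \<le> 6}"
      by (intro card_mono finite_cube) auto
    then show ?thesis by (simp add: card_cube)
  qed
qed auto

end

section \<open>Lower bounds on the infimum defining the eigenvalue\<close>

lemma infsum_box:
  fixes f :: "int ^ 'd::finite \<Rightarrow> real"
  assumes "{x. f x \<noteq> 0} \<subseteq> box n"
  shows "(\<Sum>\<^sub>\<infinity>x. (f x)\<^sup>2) = (\<Sum>x\<in>box n. (f x)\<^sup>2)"
proof -
  have "(\<Sum>\<^sub>\<infinity>x. (f x)\<^sup>2) = (\<Sum>\<^sub>\<infinity>x\<in>box n. (f x)\<^sup>2)"
    using assms by (intro infsum_cong_neutral) auto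
  then show ?thesis by simp
qed

lemma lambda1_greatest:
  fixes w :: "(int ^ 'd::finite) set \<Rightarrow> real"
  assumes "\<And>f. {x. f x \<noteq> 0} \<subseteq> box n \<Longrightarrow> (\<Sum>x\<in>box n. (f x)\<^sup>2) = 1 \<Longrightarrow> c \<le> energy w f"
  shows "c \<le> lambda1 n w"
  unfolding lambda1_def
proof (rule cInf_greatest)
  \<comment> \<open>\<open>Inf\<close> on the reals requires a nonempty set, witnessed here by the
    indicator of the origin.\<close>
  let ?f = "\<lambda>x :: int ^ 'd. of_bool (x = 0) :: real"
  have supp: "{x. ?f x \<noteq> 0} \<subseteq> box n" by (auto simp: box_def)
  have "(\<Sum>\<^sub>\<infinity>x. (?f x)\<^sup>2) = 1"
  proof -
    have "(?f x)\<^sup>2 = (if x = 0 then 1 else 0)" for x by simp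
    moreover have "(0 :: int ^ 'd) \<in> box n" by (simp add: box_def)
    ultimately show ?thesis unfolding infsum_box[OF supp] by (simp only: sum.delta[OF finite_box] if_True)
  qed
  then have "energy w ?f \<in> {energy w f |f. {x. f x \<noteq> 0} \<subseteq> box n \<and> (\<Sum>\<^sub>\<infinity>x. (f x)\<^sup>2) = 1}"
    using supp by (intro CollectI exI[of _ ?f] conjI refl)
  then show "{energy w f |f. {x. f x \<noteq> 0} \<subseteq> box n \<and> (\<Sum>\<^sub>\<infinity>x. (f x)\<^sup>2) = 1} \<noteq> {}"
    by (rule ex_in_conv[THEN iffD1, OF exI])
next
  fix y assume "y \<in> {energy w f |f. {x. f x \<noteq> 0} \<subseteq> box n \<and> (\<Sum>\<^sub>\<infinity>x. (f x)\<^sup>2) = 1}"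
  then obtain f where f: "{x. f x \<noteq> 0} \<subseteq> box n" "(\<Sum>\<^sub>\<infinity>x. (f x)\<^sup>2) = 1" "y = energy w f" by blast
  show "c \<le> y" unfolding f(3) by (rule assms[OF f(1)]) (use infsum_box[OF f(1)] f(2) in simp)
qed

section \<open>Almost sure control of the local scales along powers of two\<close>

context iid_conductances begin

lemma AE_pos: "AE \<omega> in M. \<forall>e\<in>edges. 0 < W e \<omega>"
proof -
  have "countable (edges :: (int ^ 'd) set set)"
  proof (rule countable_subset)
    show "edges \<subseteq> range (\<lambda>(x, y). {x, y :: int ^ 'd})" by (auto simp: edges_def)
  qed auto
  then show ?thesis using pos by (subst AE_ball_countable) auto
qed

text \<open>First Borel-Cantelli lemma: the union bound over the box gives a constant times
  \<open>(2 ^ k) ^ d * p (t (2 ^ k)) ^ (2 * d)\<close>, summable by condensation. Radius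
  \<open>2 ^ Suc k\<close> covers \<open>box (Suc n)\<close> for all \<open>n\<close> with
  \<open>2 ^ k \<le> n < 2 ^ Suc k\<close>.\<close>

lemma eventually_not_crowded:
  assumes t: "antimono t" and sum: "summable (\<lambda>m. (real m + 1) ^ (CARD('d) - 1) * p (t m) ^ (2 * CARD('d)))"
  shows "AE \<omega> in M. \<forall>\<^sub>F k in sequentially. \<forall>x\<in>box (2 ^ Suc k). \<not> crowded t x (2 ^ k) (env \<omega>)"
proof -
  let ?C = "2 ^ (7 ^ CARD('d))\<^sup>2 :: real"
  define A where "A k = {\<omega> \<in> space M. \<exists>x\<in>box (2 ^ Suc k). crowded t x (2 ^ k) (env \<omega>)}" for k
  have A_eq: "A k = (\<Union>x\<in>box (2 ^ Suc k). {\<omega> \<in> space M. crowded t x (2 ^ k) (env \<omega>)})" for k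
    by (auto simp: A_def)
  have meas: "A k \<in> events" for k unfolding A_eq by (intro sets.finite_UN) auto
  have bound: "prob (A k) \<le> 5 ^ CARD('d) * ?C * ((2 ^ k) ^ CARD('d) * p (t (2 ^ k)) ^ (2 * CARD('d)))" for k
  proof -
    have "prob (A k) \<le> (\<Sum>x\<in>box (2 ^ Suc k). prob {\<omega> \<in> space M. crowded t x (2 ^ k) (env \<omega>)})"
      unfolding A_eq by (intro finite_measure_subadditive_finite) auto
    also have "\<dots> \<le> (\<Sum>x\<in>(box (2 ^ Suc k) :: (int ^ 'd) set). ?C * p (t (2 ^ k)) ^ (2 * CARD('d)))"
      by (intro sum_mono prob_crowded)
    also have "\<dots> = real (2 * 2 ^ Suc k + 1) ^ CARD('d) * (?C * p (t (2 ^ k)) ^ (2 * CARD('d)))"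
      by (simp add: card_box)
    also have "\<dots> \<le> (5 * 2 ^ k) ^ CARD('d) * (?C * p (t (2 ^ k)) ^ (2 * CARD('d)))"
      by (intro mult_right_mono power_mono) (auto simp: p_bounds)
    finally show ?thesis by (simp add: power_mult_distrib mult_ac)
  qed
  have bound_sum: "summable (\<lambda>k. 5 ^ CARD('d) * ?C * ((2 ^ k) ^ CARD('d) * p (t (2 ^ k)) ^ (2 * CARD('d))))"
    using sum dim antimonoD[OF t] p_bounds p_mono
    by (intro summable_mult summable_condensed) (auto simp: antimono_def intro!: power_mono)
  have "summable (\<lambda>k. prob (A k))"
    by (rule summable_comparison_test'[OF bound_sum, of 0])
      (simp only: real_norm_def abs_of_nonneg measure_nonneg bound)
  then have "AE \<omega> in M. \<forall>\<^sub>F k in sequentially. \<omega> \<in> space M - A k"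
    by (intro borel_cantelli_AE1 meas) (simp add: emeasure_eq_measure)
  then show ?thesis by eventually_elim (auto simp: A_def elim!: eventually_mono)
qed

text \<open>The mean of the sum is of order \<open>(2 ^ k) ^ d\<close> by the first moment bound.
  Chebyshev's inequality for deviations of that same order, with the truncated variance, gives
  probabilities summable in \<open>k\<close>.\<close>

lemma eventually_scale_sum_bounded:
  assumes t: "antimono t" and sum: "summable (\<lambda>m. (real m + 1) ^ (CARD('d) - 1) * p (t m) ^ (2 * CARD('d)))"
  obtains Q where "Q \<ge> 0" "AE \<omega> in M. \<forall>\<^sub>F k in sequentially.
    (\<Sum>x\<in>box (2 ^ Suc k). real (scale t (2 ^ k) x (env \<omega>)) ^ CARD('d)) \<le> Q * (2 ^ k) ^ CARD('d)"
proof -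
  let ?C = "2 ^ (7 ^ CARD('d))\<^sup>2 :: real" and ?d = "CARD('d)"
  define b where "b m = (real m + 1) ^ (?d - 1) * p (t m) ^ (2 * ?d)" for m
  have b0: "b m \<ge> 0" for m by (simp add: b_def p_bounds)
  have sumb: "summable b" by (rule sum[folded b_def])
  have d1: "?d \<ge> 1" using dim by simp
  define S where "S k \<omega> = (\<Sum>x\<in>box (2 ^ Suc k). real (scale t (2 ^ k) x (env \<omega>)) ^ ?d)" for k \<omega>
  have Sm [measurable]: "S k \<in> borel_measurable M" for k
    unfolding S_def by (intro borel_measurable_sum scale_power_measurable t d1)
  have Sb: "\<bar>S k \<omega>\<bar> \<le> (\<Sum>x\<in>(box (2 ^ Suc k) :: (int ^ 'd) set). (2 ^ k) ^ ?d)" for k \<omega>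
  proof -
    have "S k \<omega> \<ge> 0" by (simp add: S_def sum_nonneg)
    moreover have "S k \<omega> \<le> (\<Sum>x\<in>(box (2 ^ Suc k) :: (int ^ 'd) set). (2 ^ k) ^ ?d)"
      unfolding S_def
    proof (intro sum_mono power_mono)
      fix x :: "int ^ 'd"
      have "real (scale t (2 ^ k) x (env \<omega>)) \<le> real (2 ^ k)" using scale_le by (simp only: of_nat_le_iff)
      then show "real (scale t (2 ^ k) x (env \<omega>)) \<le> 2 ^ k" by (simp only: of_nat_power of_nat_numeral)
    qed auto
    ultimately show ?thesis by simp
  qed
  \<comment> \<open>The box has side \<open>4 * 2 ^ k + 1 \<le> 5 * 2 ^ k\<close>.\<close>
  have card: "real ((2 * 2 ^ Suc k + 1) ^ ?d) \<le> 5 ^ ?d * (2 ^ k) ^ ?d" for k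
  proof -
    have "real ((2 * 2 ^ Suc k + 1) ^ ?d) = (4 * 2 ^ k + 1) ^ ?d" by (simp add: add.commute)
    also have "\<dots> \<le> (5 * 2 ^ k) ^ ?d" by (intro power_mono) auto
    finally show ?thesis by (simp add: power_mult_distrib)
  qed
  define Q1 where "Q1 = ?C * (real ?d * suminf b)"
  have Q1: "Q1 \<ge> 0" using suminf_nonneg[OF sumb b0] by (simp add: Q1_def)
  have ES: "expectation (S k) \<le> 5 ^ ?d * Q1 * (2 ^ k) ^ ?d" for k
  proof -
    have int: "integrable M (\<lambda>\<omega>. real (scale t (2 ^ k) x (env \<omega>)) ^ ?d)" for x
      using scale_le[of t "2 ^ k" x]
      by (intro integrable_const_bound[of _ "real (2 ^ k) ^ ?d"] scale_power_measurable t d1)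
        (auto intro!: power_mono simp del: of_nat_power)
    have "expectation (S k) = (\<Sum>x\<in>box (2 ^ Suc k). expectation (\<lambda>\<omega>. real (scale t (2 ^ k) x (env \<omega>)) ^ ?d))"
      unfolding S_def by (intro Bochner_Integration.integral_sum int)
    also have "\<dots> \<le> (\<Sum>x\<in>(box (2 ^ Suc k) :: (int ^ 'd) set). Q1)"
    proof (intro sum_mono order_trans[OF expectation_scale_power[OF t d1]])
      have "(\<Sum>m<2 ^ k. real ?d * (real m + 1) ^ (?d - 1) * p (t m) ^ (2 * ?d)) = real ?d * (\<Sum>m<2 ^ k. b m)"
        by (simp add: b_def sum_distrib_left mult_ac)
      also have "\<dots> \<le> real ?d * suminf b" using b0 sumb by (intro mult_left_mono sum_le_suminf) auto
      finally show "?C * (\<Sum>m<2 ^ k. real ?d * (real m + 1) ^ (?d - 1) * p (t m) ^ (2 * ?d)) \<le> Q1"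
        unfolding Q1_def by (intro mult_left_mono) auto
    qed
    also have "\<dots> = real ((2 * 2 ^ Suc k + 1) ^ ?d) * Q1" by (simp only: sum_constant card_box)
    also have "\<dots> \<le> (5 ^ ?d * (2 ^ k) ^ ?d) * Q1" by (intro mult_right_mono card Q1)
    finally show ?thesis by (simp add: mult_ac)
  qed
  define A where "A k = {\<omega> \<in> space M. \<bar>S k \<omega> - expectation (S k)\<bar> \<ge> (2 ^ k) ^ ?d}" for k
  define T where "T k = (\<Sum>m<2 ^ k. (real m + 1) ^ ?d * b m) / (2 ^ k) ^ ?d" for k
  have bound: "prob (A k) \<le> 5 ^ ?d * 13 ^ ?d * ?C * real (2 * ?d) * T k" for k
  proof -
    define N :: real where "N = (2 ^ k) ^ ?d"
    have N0: "N > 0" by (simp add: N_def)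
    have T0: "T k \<ge> 0" using b0 by (auto simp: T_def intro!: sum_nonneg divide_nonneg_nonneg)
    have "prob (A k) \<le> variance (S k) / N\<^sup>2"
      unfolding A_def N_def
    proof (rule Chebyshev_inequality[OF Sm])
      show "integrable M (\<lambda>x. (S k x)\<^sup>2)"
        using Sb by (intro integrable_const_bound[of _ "(\<Sum>x\<in>(box (2 ^ Suc k) :: (int ^ 'd) set). (2 ^ k) ^ ?d)\<^sup>2"])
          (auto simp: abs_le_square_iff[symmetric] sum_nonneg)
    qed simp
    also have "variance (S k) \<le> real ((2 * 2 ^ Suc k + 1) ^ ?d) * real (13 ^ ?d) * (?C *
      (\<Sum>m<2 ^ k. real (2 * ?d) * (real m + 1) ^ (2 * ?d - 1) * p (t m) ^ (2 * ?d)))"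
      unfolding S_def by (rule variance_sum_scale[OF t])
    \<comment> \<open>Splitting the exponent as \<open>d + (d - 1)\<close> exhibits
      \<open>N * T k\<close>. Together with the box volume of order \<open>N\<close>, the division
      by \<open>N\<^sup>2\<close> leaves a constant times \<open>T k\<close>.\<close>
    also have "(\<Sum>m<2 ^ k. real (2 * ?d) * (real m + 1) ^ (2 * ?d - 1) * p (t m) ^ (2 * ?d)) = real (2 * ?d) * (N * T k)"
    proof -
      have "2 * ?d - 1 = ?d + (?d - 1)" using d1 by simp
      then have "(\<Sum>m<2 ^ k. real (2 * ?d) * (real m + 1) ^ (2 * ?d - 1) * p (t m) ^ (2 * ?d))
        = real (2 * ?d) * (\<Sum>m<2 ^ k. (real m + 1) ^ ?d * b m)"
        by (simp only: power_add b_def sum_distrib_left mult_ac)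
      then show ?thesis by (simp add: T_def N_def)
    qed
    also have "real ((2 * 2 ^ Suc k + 1) ^ ?d) * real (13 ^ ?d) * (?C * (real (2 * ?d) * (N * T k)))
      \<le> (5 ^ ?d * N) * real (13 ^ ?d) * (?C * (real (2 * ?d) * (N * T k)))"
      using card[of k] T0 N0 by (intro mult_right_mono mult_nonneg_nonneg) (auto simp: N_def)
    finally have "prob (A k) \<le> (5 ^ ?d * N) * real (13 ^ ?d) * (?C * (real (2 * ?d) * (N * T k))) / N\<^sup>2"
      by (simp add: divide_right_mono)
    then show ?thesis using N0 by (simp add: power2_eq_square mult_ac)
  qed
  have bound_sum: "summable (\<lambda>k. 5 ^ ?d * 13 ^ ?d * ?C * real (2 * ?d) * T k)"
    unfolding T_def by (intro summable_mult summable_dyadic_truncation b0 d1 sumb)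
  have "summable (\<lambda>k. prob (A k))"
    by (rule summable_comparison_test'[OF bound_sum, of 0])
      (simp only: real_norm_def abs_of_nonneg measure_nonneg bound)
  then have AE: "AE \<omega> in M. \<forall>\<^sub>F k in sequentially. \<omega> \<in> space M - A k"
    by (intro borel_cantelli_AE1) (auto simp: A_def emeasure_eq_measure)
  have "AE \<omega> in M. \<forall>\<^sub>F k in sequentially. S k \<omega> \<le> (5 ^ ?d * Q1 + 1) * (2 ^ k) ^ ?d"
    using AE
  proof eventually_elim
    case (elim \<omega>)
    then show ?case
    proof eventually_elim
      case (elim k)
      then have "S k \<omega> - expectation (S k) < (2 ^ k) ^ ?d" by (auto simp: A_def)
      then show ?case using ES[of k] by (simp add: algebra_simps)
    qed
  qed
  then show ?thesis using Q1 that[of "5 ^ ?d * Q1 + 1"] by (simp add: S_def)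
qed

end

lemma Suc_power_le: "(real a + 1) ^ k \<le> 2 ^ k * (real a ^ k + 1)"
proof (cases "a = 0")
  case False
  then have "(real a + 1) ^ k \<le> (2 * real a) ^ k" by (intro power_mono) auto
  also have "\<dots> = 2 ^ k * real a ^ k" by (simp add: power_mult_distrib)
  also have "\<dots> \<le> 2 ^ k * (real a ^ k + 1)" by (intro mult_left_mono) auto
  finally show ?thesis .
qed (simp add: power_0_left)

context iid_conductances begin

text \<open>For \<open>2 ^ k \<le> n < 2 ^ (k + 1)\<close> the scales capped at \<open>2 ^ k\<close>
  satisfy all hypotheses of \<open>energy_ge_of_local_scales\<close>, with a constant independent of
  \<open>n\<close> and of the environment.\<close>

theorem lambda1_lower_bound:
  fixes t :: "nat \<Rightarrow> real" and K :: real
  assumes t: "antimono t" and tpos: "\<And>m. t m > 0" and K: "K > 0"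
    and U: "\<And>n r. r \<le> n \<Longrightarrow> (real n)\<^sup>2 * t n \<le> K * (real r + 1)\<^sup>2 * t r"
    and sum: "summable (\<lambda>m. (real m + 1) ^ (CARD('d) - 1) * p (t m) ^ (2 * CARD('d)))"
  shows "\<exists>c>0. AE \<omega> in M. \<forall>\<^sub>F n in sequentially. c * t n \<le> lambda1 n (env \<omega>)"
proof -
  let ?d = "CARD('d)"
  obtain Q where Q: "Q \<ge> 0" "AE \<omega> in M. \<forall>\<^sub>F k in sequentially.
    (\<Sum>x\<in>box (2 ^ Suc k). real (scale t (2 ^ k) x (env \<omega>)) ^ ?d) \<le> Q * (2 ^ k) ^ ?d"
    using eventually_scale_sum_bounded[OF t sum] by blast
  \<comment> \<open>\<open>(R x + 1) ^ d\<close> is at most \<open>2 ^ d * ((R x) ^ d + 1)\<close>;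
    \<open>Q\<close> bounds the sum of the powers and \<open>5 ^ d\<close> the number of sites, both
    relative to \<open>(2 ^ k) ^ d\<close>.\<close>
  define P where "P = 2 ^ ?d * (Q + 5 ^ ?d)"
  have P: "P > 0" using Q(1) by (simp add: P_def add_nonneg_pos)
  define C where "C = (4 * ?d * (?d * P) powr (1 / ?d))\<^sup>2 * (162 * ?d * K * 7 ^ ?d)"
  have C: "C > 0" using dim P K by (simp add: C_def zero_less_mult_iff)
  have "AE \<omega> in M. \<forall>\<^sub>F n in sequentially. (1 / C) * t n \<le> lambda1 n (env \<omega>)"
    using Q(2) eventually_not_crowded[OF t sum] AE_pos
  proof eventually_elim
    case (elim \<omega>)
    from eventually_conj[OF elim(1,2)] obtain k0 where k0: "\<And>k. k \<ge> k0 \<Longrightarrow>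
      (\<Sum>x\<in>box (2 ^ Suc k). real (scale t (2 ^ k) x (env \<omega>)) ^ ?d) \<le> Q * (2 ^ k) ^ ?d \<and>
      (\<forall>x\<in>box (2 ^ Suc k). \<not> crowded t x (2 ^ k) (env \<omega>))"
      unfolding eventually_sequentially by blast
    have "(1 / C) * t n \<le> lambda1 n (env \<omega>)" if n: "n \<ge> 2 ^ k0" for n
    proof (rule lambda1_greatest)
      fix f :: "int ^ 'd \<Rightarrow> real"
      assume f: "{x. f x \<noteq> 0} \<subseteq> box n" "(\<Sum>x\<in>box n. (f x)\<^sup>2) = 1"
      have n1: "n \<ge> 1" using n by (metis le_trans one_le_numeral one_le_power)
      obtain k where k: "2 ^ k \<le> n" "n < 2 ^ (k + 1)" using ex_power_ivl1[of 2 n] n1 by auto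
      have kk0: "k \<ge> k0"
      proof (rule ccontr)
        assume "\<not> k \<ge> k0"
        then have "(2::nat) ^ (k + 1) \<le> 2 ^ k0" by (intro power_increasing) auto
        then show False using k n by simp
      qed
      define R where "R x = scale t (2 ^ k) x (env \<omega>)" for x
      have sub: "box (Suc n) \<subseteq> (box (2 ^ Suc k) :: (int ^ 'd) set)" using k by (intro box_mono) simp
      have "t n \<le> C * energy (env \<omega>) f" unfolding C_def
      proof (rule energy_ge_of_local_scales[OF dim _ f n1 tpos U])
        show "0 \<le> env \<omega> e" if "e \<in> edges" for e using elim(3) that by (auto intro: less_imp_le)
        show "R x \<le> n" for x using scale_le[of t "2 ^ k" x "env \<omega>"] k by (simp add: R_def)
        show "card {e \<in> nbhd x. env \<omega> e \<le> t (R x)} < 2 * ?d" if "x \<in> box (Suc n)" for x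
        proof -
          have "\<not> crowded t x (2 ^ k) (env \<omega>)" using k0[OF kk0] sub that by auto
          then have "\<not> crowded t x (R x) (env \<omega>)" unfolding R_def by (rule not_crowded_scale)
          then show ?thesis by (simp add: crowded_def not_le)
        qed
        have "(\<Sum>x\<in>box (Suc n). (real (R x) + 1) ^ ?d) \<le> (\<Sum>x\<in>box (2 ^ Suc k). (real (R x) + 1) ^ ?d)"
          using sub by (intro sum_mono2) auto
        also have "\<dots> \<le> (\<Sum>x\<in>box (2 ^ Suc k). 2 ^ ?d * (real (R x) ^ ?d + 1))"
          by (intro sum_mono Suc_power_le)
        also have "\<dots> = 2 ^ ?d * ((\<Sum>x\<in>box (2 ^ Suc k). real (R x) ^ ?d) + real ((2 * 2 ^ Suc k + 1) ^ ?d))"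
          by (simp only: sum_distrib_left[symmetric] sum.distrib sum_constant card_box mult_1_right)
        also have "\<dots> \<le> 2 ^ ?d * (Q * (2 ^ k) ^ ?d + 5 ^ ?d * (2 ^ k) ^ ?d)"
        proof (intro mult_left_mono add_mono)
          show "(\<Sum>x\<in>box (2 ^ Suc k). real (R x) ^ ?d) \<le> Q * (2 ^ k) ^ ?d"
            using k0[OF kk0] by (simp add: R_def)
          have "real ((2 * 2 ^ Suc k + 1) ^ ?d) = (4 * 2 ^ k + 1) ^ ?d" by (simp add: add.commute)
          also have "\<dots> \<le> (5 * 2 ^ k) ^ ?d" by (intro power_mono) auto
          finally show "real ((2 * 2 ^ Suc k + 1) ^ ?d) \<le> 5 ^ ?d * (2 ^ k) ^ ?d"
            by (simp add: power_mult_distrib)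
        qed simp
        also have "\<dots> = P * (2 ^ k) ^ ?d" by (simp add: P_def algebra_simps)
        also have "\<dots> \<le> P * real n ^ ?d"
        proof (intro mult_left_mono power_mono)
          have "real (2 ^ k) \<le> real n" using k(1) by (simp only: of_nat_le_iff)
          then show "2 ^ k \<le> real n" by (simp only: of_nat_power of_nat_numeral)
        qed (use P in auto)
        finally show "(\<Sum>x\<in>box (Suc n). (real (R x) + 1) ^ ?d) \<le> P * real n ^ ?d" .
      qed
      then show "1 / C * t n \<le> energy (env \<omega>) f" using C by (simp add: field_simps)
    qed
    then show ?case unfolding eventually_sequentially by blast
  qed
  then show ?thesis using C by (intro exI[of _ "1 / C"]) auto
qed

end

section \<open>The upper bound\<close>

lemma energy_nonneg:
  fixes w :: "(int ^ 'd::finite) set \<Rightarrow> real"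
  assumes "\<And>e. e \<in> edges \<Longrightarrow> 0 \<le> w e"
  shows "0 \<le> energy w f"
  unfolding energy_def using assms
  by (intro mult_nonneg_nonneg infsum_nonneg) (auto simp: edges_def intro!: mult_nonneg_nonneg)

lemma lambda1_nonneg:
  fixes w :: "(int ^ 'd::finite) set \<Rightarrow> real"
  assumes "\<And>e. e \<in> edges \<Longrightarrow> 0 \<le> w e"
  shows "0 \<le> lambda1 n w"
  using energy_nonneg[OF assms] by (intro lambda1_greatest)

definition star :: "int ^ 'd \<Rightarrow> (int ^ 'd) set set" where
  "star x = {e \<in> edges. x \<in> e}"

text \<open>An integer vector of \<open>l1\<close> norm 1 has one nonzero entry, of modulus
  1.\<close>

lemma adj_imp_basis:
  fixes x y :: "int ^ 'd::finite"
  assumes "adj x y"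
  obtains i where "y = x + basis i \<or> y = x - basis i"
proof -
  define z where "z = y - x"
  have s: "(\<Sum>i\<in>UNIV. \<bar>z $ i\<bar>) = 1" using assms by (simp add: adj_def z_def abs_minus_commute)
  then obtain i where i: "z $ i \<noteq> 0" by fastforce
  have "(\<Sum>i\<in>UNIV. \<bar>z $ i\<bar>) = \<bar>z $ i\<bar> + (\<Sum>j\<in>UNIV - {i}. \<bar>z $ j\<bar>)" by (rule sum.remove) auto
  moreover have "(\<Sum>j\<in>UNIV - {i}. \<bar>z $ j\<bar>) \<ge> 0" by (intro sum_nonneg) auto
  ultimately have zi: "\<bar>z $ i\<bar> = 1" and "(\<Sum>j\<in>UNIV - {i}. \<bar>z $ j\<bar>) = 0" using s i by linarith+
  then have "z $ j = 0" if "j \<noteq> i" for j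
    using sum_nonneg_eq_0_iff[of "UNIV - {i}" "\<lambda>j. \<bar>z $ j\<bar>"] that by simp
  then have "z = basis i \<or> z = - basis i" using zi by (auto simp: vec_eq_iff axis_def abs_if split: if_splits)
  then show ?thesis using that[of i] by (auto simp: z_def algebra_simps)
qed

definition nbrs :: "int ^ 'd \<Rightarrow> (int ^ 'd) set" where
  "nbrs x = {y. adj x y}"

lemma nbrs_eq: "nbrs (x :: int ^ 'd::finite) = range (\<lambda>i. x + basis i) \<union> range (\<lambda>i. x - basis i)"
proof (intro equalityI subsetI)
  fix y assume "y \<in> nbrs x"
  then show "y \<in> range (\<lambda>i. x + basis i) \<union> range (\<lambda>i. x - basis i)"
    by (auto simp: nbrs_def elim: adj_imp_basis)
next
  fix y assume "y \<in> range (\<lambda>i. x + basis i) \<union> range (\<lambda>i. x - basis i)"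
  then show "y \<in> nbrs x" by (auto simp: nbrs_def intro: adj_add_basis adjI)
qed

lemma finite_nbrs: "finite (nbrs (x :: int ^ 'd::finite))"
  and card_nbrs: "card (nbrs (x :: int ^ 'd)) \<le> 2 * CARD('d)"
proof -
  show "finite (nbrs x)" unfolding nbrs_eq by simp
  have "card (nbrs x) \<le> card (range (\<lambda>i. x + basis i)) + card (range (\<lambda>i. x - basis i))"
    unfolding nbrs_eq by (rule card_Un_le)
  also have "\<dots> \<le> CARD('d) + CARD('d)" by (intro add_mono card_image_le) auto
  finally show "card (nbrs x) \<le> 2 * CARD('d)" by simp
qed

lemma star_eq: "star x = (\<lambda>y. {x, y}) ` nbrs (x :: int ^ 'd::finite)"
  by (auto simp: star_def edges_def nbrs_def dest: adj_sym)

lemma finite_star: "finite (star (x :: int ^ 'd::finite))"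
  and card_star: "card (star (x :: int ^ 'd)) \<le> 2 * CARD('d)"
  unfolding star_eq using finite_nbrs card_nbrs[of x] card_image_le[OF finite_nbrs, of "\<lambda>y. {x, y}" x]
  by auto

lemma star_disjoint:
  fixes x y :: "int ^ 'd::finite"
  assumes "x \<noteq> y" "\<not> adj x y"
  shows "star x \<inter> star y = {}"
  using assms by (auto simp: star_def edges_def dest: adj_sym)

text \<open>The indicator of \<open>x\<close> has as energy the total conductance of the at most
  \<open>2 * CARD('d)\<close> edges at \<open>x\<close>. Nonnegative conductances bound the
  admissible energies below, as the infimum requires.\<close>

lemma lambda1_le_star:
  fixes w :: "(int ^ 'd::finite) set \<Rightarrow> real" and s :: real
  assumes w: "\<And>e. e \<in> edges \<Longrightarrow> 0 \<le> w e" and x: "x \<in> box n" and s: "\<And>e. e \<in> star x \<Longrightarrow> w e \<le> s" "0 \<le> s"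
  shows "lambda1 n w \<le> 2 * CARD('d) * s"
proof -
  let ?f = "\<lambda>y :: int ^ 'd. if y = x then 1 else 0 :: real"
  \<comment> \<open>The two orientations of the edges at \<open>x\<close>, later compensated by the
    factor \<open>1/2\<close>.\<close>
  let ?A = "(\<lambda>y. (x, y)) ` nbrs x" and ?B = "(\<lambda>y. (y, x)) ` nbrs x"
  have supp: "{y. ?f y \<noteq> 0} \<subseteq> box n" using x by auto
  have "(?f y)\<^sup>2 = (if y = x then 1 else 0)" for y by simp
  then have norm: "(\<Sum>\<^sub>\<infinity>y. (?f y)\<^sup>2) = 1"
    unfolding infsum_box[OF supp] by (simp only: sum.delta[OF finite_box] x if_True)
  have irr: "\<not> adj x x" by (simp add: adj_def)
  have "(\<Sum>\<^sub>\<infinity>(a, b)\<in>{(a, b). adj a b}. w {a, b} * (?f a - ?f b)^2)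
    = (\<Sum>\<^sub>\<infinity>(a, b)\<in>?A \<union> ?B. w {a, b} * (?f a - ?f b)^2)"
    by (rule infsum_cong_neutral) (auto simp: nbrs_def image_iff dest: adj_sym split: if_splits)
  also have "\<dots> = (\<Sum>(a, b)\<in>?A \<union> ?B. w {a, b} * (?f a - ?f b)^2)"
    by (rule infsum_finite) (simp add: finite_nbrs)
  also have "\<dots> \<le> (\<Sum>p\<in>?A \<union> ?B. s)"
  proof (rule sum_mono)
    fix p assume "p \<in> ?A \<union> ?B"
    then obtain y where y: "adj x y" "p = (x, y) \<or> p = (y, x)" by (auto simp: nbrs_def)
    then have "w {x, y} \<le> s" by (intro s) (auto simp: star_def edges_def)
    moreover have "{y, x} = {x, y}" by auto
    ultimately show "(case p of (a, b) \<Rightarrow> w {a, b} * (?f a - ?f b)^2) \<le> s"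
      using y irr by auto
  qed
  also have "\<dots> \<le> real (2 * (2 * CARD('d))) * s"
  proof -
    have "card (?A \<union> ?B) \<le> card ?A + card ?B" by (rule card_Un_le)
    also have "\<dots> \<le> card (nbrs x) + card (nbrs x)" by (intro add_mono card_image_le finite_nbrs)
    finally have "card (?A \<union> ?B) \<le> 2 * (2 * CARD('d))" using card_nbrs[of x] by linarith
    then show ?thesis using s(2) by (simp only: sum_constant) (intro mult_right_mono, simp_all only: of_nat_le_iff)
  qed
  finally have E: "energy w ?f \<le> 2 * CARD('d) * s" by (simp add: energy_def)
  have "lambda1 n w \<le> energy w ?f"
    unfolding lambda1_def
  proof (rule cInf_lower)
    show "energy w ?f \<in> {energy w f |f. {x. f x \<noteq> 0} \<subseteq> box n \<and> (\<Sum>\<^sub>\<infinity>x. (f x)\<^sup>2) = 1}"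
      using supp norm by (intro CollectI exI[of _ ?f] conjI refl)
    show "bdd_below {energy w f |f. {x. f x \<noteq> 0} \<subseteq> box n \<and> (\<Sum>\<^sub>\<infinity>x. (f x)\<^sup>2) = 1}"
      using energy_nonneg[OF w] by (intro bdd_belowI[of _ 0]) fastforce
  qed
  with E show ?thesis by linarith
qed

section \<open>Sites with small conductances on all incident edges, by a second Borel-Cantelli
  argument\<close>

context iid_conductances begin

text \<open>Distinct nonadjacent sites have disjoint stars, so the events are independent. Each has
  probability at most \<open>1 - p (s x) ^ (2 * CARD('d))\<close>, because a star has at most
  \<open>2 * CARD('d)\<close> edges, and \<open>1 - z \<le> exp (- z)\<close> turns the product into
  a sum.\<close>

lemma prob_no_small_star:
  fixes s :: "int ^ 'd \<Rightarrow> real"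
  assumes F: "finite F" and nonadj: "\<And>x y. x \<in> F \<Longrightarrow> y \<in> F \<Longrightarrow> \<not> adj x y"
  shows "prob {\<omega> \<in> space M. \<forall>x\<in>F. \<exists>e\<in>star x. s x < W e \<omega>} \<le> exp (- (\<Sum>x\<in>F. p (s x) ^ (2 * CARD('d))))"
proof (cases "F = {}")
  case True
  then show ?thesis by (simp add: prob_space)
next
  case False
  define Y :: "int ^ 'd \<Rightarrow> ((int ^ 'd) set \<Rightarrow> real) \<Rightarrow> real" where
    "Y x v = of_bool (\<forall>e\<in>star x. v e \<le> s x)" for x v
  have Ym: "Y x \<in> borel_measurable (PiM (star x) (\<lambda>_. borel))" for x
  proof -
    have [measurable]: "Measurable.pred (PiM (star x) (\<lambda>_. borel)) (\<lambda>v. \<forall>e\<in>star x. v e \<le> s x)"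
    proof (intro measurable_pred_countable finite_star countable_finite)
      fix e assume "e \<in> star x"
      then have "(\<lambda>v. v e) \<in> borel_measurable (PiM (star x) (\<lambda>_. borel))"
        by (rule measurable_component_singleton)
      then show "Measurable.pred (PiM (star x) (\<lambda>_. borel)) (\<lambda>v. v e \<le> s x)" by measurable
    qed
    show ?thesis unfolding Y_def by measurable
  qed
  have sub: "star x \<subseteq> edges" for x :: "int ^ 'd" by (auto simp: star_def)
  have "indep_vars (\<lambda>x. PiM (star x) (\<lambda>_. borel)) (\<lambda>x \<omega>. restrict (env \<omega>) (star x)) F"
    using star_disjoint nonadj by (intro indep_vars_restrict[OF indep sub]) (auto simp: disjoint_family_on_def)
  from indep_vars_compose2[OF this, of Y "\<lambda>_. borel"] Ym
  have ind: "indep_vars (\<lambda>_. borel) (\<lambda>x \<omega>. Y x (restrict (env \<omega>) (star x))) F" by auto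
  have Y0: "(\<lambda>\<omega>. Y x (restrict (env \<omega>) (star x))) -` {0} \<inter> space M = {\<omega> \<in> space M. \<exists>e\<in>star x. s x < W e \<omega>}" for x
    by (auto simp: Y_def not_le)
  have "{\<omega> \<in> space M. \<forall>x\<in>F. \<exists>e\<in>star x. s x < W e \<omega>}
    = (\<Inter>x\<in>F. (\<lambda>\<omega>. Y x (restrict (env \<omega>) (star x))) -` {0} \<inter> space M)"
    unfolding Y0 using False by auto
  also have "prob \<dots> = (\<Prod>x\<in>F. prob ((\<lambda>\<omega>. Y x (restrict (env \<omega>) (star x))) -` {0} \<inter> space M))"
    by (rule indep_varsD_finite[OF ind False F]) auto
  also have "\<dots> \<le> (\<Prod>x\<in>F. exp (- (p (s x) ^ (2 * CARD('d)))))"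
  proof (intro prod_mono conjI)
    fix x
    have m: "{\<omega> \<in> space M. \<forall>e\<in>star x. W e \<omega> \<le> s x} \<in> events"
      using finite_star by (intro sets.sets_Collect_finite_All) (auto simp: star_def)
    have "{\<omega> \<in> space M. \<exists>e\<in>star x. s x < W e \<omega>} = space M - {\<omega> \<in> space M. \<forall>e\<in>star x. W e \<omega> \<le> s x}"
      by (auto simp: not_le)
    then have "prob {\<omega> \<in> space M. \<exists>e\<in>star x. s x < W e \<omega>} = 1 - p (s x) ^ card (star x)"
      using m by (simp add: prob_compl prob_all_le[OF finite_star sub])
    also have "\<dots> \<le> 1 - p (s x) ^ (2 * CARD('d))"
      using p_bounds card_star[of x] by (simp add: power_decreasing)
    also have "\<dots> \<le> exp (- (p (s x) ^ (2 * CARD('d))))"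
      using exp_ge_add_one_self[of "- (p (s x) ^ (2 * CARD('d)))"] by simp
    finally show "prob ((\<lambda>\<omega>. Y x (restrict (env \<omega>) (star x))) -` {0} \<inter> space M) \<le> exp (- (p (s x) ^ (2 * CARD('d))))"
      by (simp only: Y0)
  qed simp
  also have "\<dots> = exp (- (\<Sum>x\<in>F. p (s x) ^ (2 * CARD('d))))"
    by (simp add: exp_sum[OF F, symmetric] sum_negf)
  finally show ?thesis .
qed

text \<open>Second Borel-Cantelli argument on even sites: the probability that no site in the layers
  from \<open>m0\<close> to \<open>m1\<close> has a small star is at most the exponential of minus a
  partial sum of a divergent series.\<close>

lemma frequently_small_star:
  fixes s :: "nat \<Rightarrow> real"
  assumes nsum: "\<not> summable (\<lambda>m. (real m + 1) ^ (CARD('d) - 1) * p (s (2 * m)) ^ (2 * CARD('d)))"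
  shows "AE \<omega> in M. \<exists>\<^sub>F n in sequentially. \<exists>x\<in>box n. \<forall>e\<in>star x. W e \<omega> \<le> s n"
proof -
  fix i0 :: 'd
  \<comment> \<open>The layer \<open>L m\<close> is a face of the even cube: coordinate
    \<open>i0\<close> equals \<open>2 * m\<close>, the others are even numbers from 0 to
    \<open>2 * m\<close>. It has \<open>(m + 1) ^ (d - 1)\<close> sites, lies in
    \<open>box (2 * m)\<close>, and different layers are disjoint.\<close>
  define V where "V m i = (if i = i0 then {2 * int m} else (\<lambda>j. 2 * int j) ` {..m})" for m :: nat and i
  define L :: "nat \<Rightarrow> (int ^ 'd) set" where "L m = {x. \<forall>i. x $ i \<in> V m i}" for m
  define a where "a m = (real m + 1) ^ (CARD('d) - 1) * p (s (2 * m)) ^ (2 * CARD('d))" for m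
  \<comment> \<open>Recovers \<open>2 * m\<close> from a site of \<open>L m\<close>, so that the
    threshold can depend on the site alone.\<close>
  define lev :: "int ^ 'd \<Rightarrow> nat" where "lev x = nat (x $ i0)" for x
  have a0: "a m \<ge> 0" for m by (simp add: a_def p_bounds)
  have finL: "finite (L m)" for m
    unfolding L_def by (rule card_vec_prod(2)) (auto simp: V_def)
  have cardL: "card (L m) = (m + 1) ^ (CARD('d) - 1)" for m
  proof -
    have "card (L m) = (\<Prod>i\<in>UNIV. card (V m i))" unfolding L_def by (rule card_vec_prod(1))
    also have "\<dots> = (\<Prod>i\<in>UNIV - {i0}. card (V m i))"
      by (subst prod.remove[of _ i0]) (auto simp: V_def)
    also have "\<dots> = (\<Prod>i\<in>UNIV - {i0}. m + 1)"
    proof (rule prod.cong[OF refl])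
      fix i assume "i \<in> UNIV - {i0}"
      then have "card (V m i) = card ((\<lambda>j. 2 * int j) ` {..m})" by (simp add: V_def)
      also have "\<dots> = card {..m}" by (rule card_image) (auto simp: inj_on_def)
      finally show "card (V m i) = m + 1" by simp
    qed
    finally show ?thesis by (simp add: card_Diff_singleton)
  qed
  have levL: "lev x = 2 * m" if "x \<in> L m" for x m
  proof -
    have "x $ i0 \<in> V m i0" using that unfolding L_def by blast
    then show ?thesis by (simp add: V_def lev_def nat_mult_distrib)
  qed
  have boxL: "x \<in> box (2 * m)" if "x \<in> L m" for x m
    unfolding box_def
  proof (intro CollectI allI)
    fix i
    have "x $ i \<in> V m i" using that by (simp add: L_def)
    then show "\<bar>x $ i\<bar> \<le> int (2 * m)" by (auto simp: V_def split: if_splits)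
  qed
  have evenL: "even (x $ i)" if "x \<in> L m" for x m i
  proof -
    have "x $ i \<in> V m i" using that by (simp add: L_def)
    then show ?thesis by (auto simp: V_def split: if_splits)
  qed
  have nonadj: "\<not> adj x y" if "x \<in> L m" "y \<in> L m'" for x y m m'
  proof
    assume "adj x y"
    then obtain i where "y = x + basis i \<or> y = x - basis i" by (rule adj_imp_basis)
    then have "y $ i = x $ i + 1 \<or> y $ i = x $ i - 1" by auto
    then show False using evenL[OF that(1), of i] evenL[OF that(2), of i] by auto
  qed
  have disj: "L m \<inter> L m' = {}" if "m \<noteq> m'" for m m'
  proof (rule ccontr)
    assume "L m \<inter> L m' \<noteq> {}"
    then obtain x where "x \<in> L m" "x \<in> L m'" by blast
    then show False using levL[of x m] levL[of x m'] that by simp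
  qed
  define B where "B m0 m1 = {\<omega> \<in> space M. \<forall>x\<in>(\<Union>m\<in>{m0..<m1}. L m). \<exists>e\<in>star x. s (lev x) < W e \<omega>}" for m0 m1
  have B_prob: "prob (B m0 m1) \<le> exp (- (\<Sum>m\<in>{m0..<m1}. a m))" for m0 m1
  proof -
    have "prob (B m0 m1) \<le> exp (- (\<Sum>x\<in>(\<Union>m\<in>{m0..<m1}. L m). p (s (lev x)) ^ (2 * CARD('d))))"
      unfolding B_def using finL nonadj by (intro prob_no_small_star) auto
    also have "(\<Sum>x\<in>(\<Union>m\<in>{m0..<m1}. L m). p (s (lev x)) ^ (2 * CARD('d)))
      = (\<Sum>m\<in>{m0..<m1}. \<Sum>x\<in>L m. p (s (lev x)) ^ (2 * CARD('d)))"
      using finL disj by (intro sum.UNION_disjoint) auto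
    also have "\<dots> = (\<Sum>m\<in>{m0..<m1}. a m)"
    proof (rule sum.cong[OF refl])
      fix m
      have "(\<Sum>x\<in>L m. p (s (lev x)) ^ (2 * CARD('d))) = (\<Sum>x\<in>L m. p (s (2 * m)) ^ (2 * CARD('d)))"
        by (intro sum.cong) (simp_all add: levL)
      then show "(\<Sum>x\<in>L m. p (s (lev x)) ^ (2 * CARD('d))) = a m"
        by (simp add: cardL a_def add.commute)
    qed
    finally show ?thesis .
  qed
  have B_meas: "B m0 m1 \<in> events" for m0 m1
  proof -
    have "Measurable.pred M (\<lambda>\<omega>. \<exists>e\<in>star x. s (lev x) < W e \<omega>)" for x :: "int ^ 'd"
      using finite_star[of x] by (intro pred_intros_finite) (auto simp: star_def)
    then show ?thesis unfolding B_def using finL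
      by (intro sets.sets_Collect_finite_All) (auto simp: pred_def)
  qed
  have "AE \<omega> in M. \<exists>m1. \<omega> \<notin> B m0 m1" for m0
  proof -
    \<comment> \<open>A positive value \<open>\<epsilon>\<close> would bound all partial sums from
      \<open>m0\<close> on by \<open>- ln \<epsilon>\<close>, contradicting divergence.\<close>
    have "prob (\<Inter>m1. B m0 m1) = 0"
    proof (rule ccontr)
      assume ne: "prob (\<Inter>m1. B m0 m1) \<noteq> 0"
      define \<epsilon> where "\<epsilon> = prob (\<Inter>m1. B m0 m1)"
      have \<epsilon>: "\<epsilon> > 0" using ne by (simp add: \<epsilon>_def zero_less_measure_iff)
      have "summable (\<lambda>m. a (m + m0))"
      proof (rule summableI_nonneg_bounded[where x = "- ln \<epsilon>"])
        fix n
        have "\<epsilon> \<le> prob (B m0 (n + m0))"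
          unfolding \<epsilon>_def by (intro finite_measure_mono B_meas) auto
        also have "\<dots> \<le> exp (- (\<Sum>m\<in>{m0..<n + m0}. a m))" by (rule B_prob)
        finally have "ln \<epsilon> \<le> - (\<Sum>m\<in>{m0..<n + m0}. a m)" using \<epsilon> by (metis exp_gt_zero ln_exp ln_le_cancel_iff)
        moreover have "(\<Sum>m\<in>{m0..<n + m0}. a m) = (\<Sum>m<n. a (m + m0))"
          using sum.shift_bounds_nat_ivl[of a 0 m0 n] by (simp add: lessThan_atLeast0)
        ultimately show "(\<Sum>m<n. a (m + m0)) \<le> - ln \<epsilon>" by simp
      qed (rule a0)
      then have "summable a" by (simp add: summable_iff_shift)
      then show False using nsum by (simp add: a_def[abs_def])
    qed
    then have "(\<Inter>m1. B m0 m1) \<in> null_sets M"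
      using B_meas by (intro null_setsI) (auto simp: emeasure_eq_measure)
    then have "AE \<omega> in M. \<omega> \<notin> (\<Inter>m1. B m0 m1)" by (rule AE_not_in)
    then show ?thesis by simp
  qed
  then have "AE \<omega> in M. \<forall>m0. \<exists>m1. \<omega> \<notin> B m0 m1" by (simp add: AE_all_countable)
  then show ?thesis using AE_space
  proof eventually_elim
    case (elim \<omega>)
    show ?case unfolding frequently_sequentially
    proof
      fix N
      obtain m1 where "\<omega> \<notin> B N m1" using elim(1) by blast
      then obtain m x where mx: "m \<in> {N..<m1}" "x \<in> L m" "\<forall>e\<in>star x. W e \<omega> \<le> s (lev x)"
        using elim(2) by (auto simp: B_def not_less)
      then have "x \<in> box (2 * m)" "\<forall>e\<in>star x. W e \<omega> \<le> s (2 * m)" using boxL levL by auto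
      moreover have "N \<le> 2 * m" using mx(1) by simp
      ultimately show "\<exists>n\<ge>N. \<exists>x\<in>box n. \<forall>e\<in>star x. W e \<omega> \<le> s n" by blast
    qed
  qed
qed

text \<open>The condition \<open>n \<ge> 1\<close> is carried along because \<open>s\<close> is
  known to be nonnegative only there.\<close>

theorem lambda1_upper_bound:
  fixes s :: "nat \<Rightarrow> real"
  assumes nsum: "\<not> summable (\<lambda>m. (real m + 1) ^ (CARD('d) - 1) * p (s (2 * m)) ^ (2 * CARD('d)))"
    and s: "\<And>n. n \<ge> 1 \<Longrightarrow> 0 \<le> s n"
  shows "AE \<omega> in M. \<exists>\<^sub>F n in sequentially. n \<ge> 1 \<and> lambda1 n (env \<omega>) \<le> 2 * CARD('d) * s n"
  using frequently_small_star[OF nsum] AE_pos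
proof eventually_elim
  case (elim \<omega>)
  have "\<exists>\<^sub>F n in sequentially. n \<ge> 1 \<and> (\<exists>x\<in>box n. \<forall>e\<in>star x. W e \<omega> \<le> s n)"
    using elim(1) eventually_ge_at_top[of 1] by (auto simp: frequently_eventually_conj conj_commute dest: frequently_eventually_frequently)
  then show ?case
  proof (rule frequently_elim1)
    fix n assume n: "n \<ge> 1 \<and> (\<exists>x\<in>box n. \<forall>e\<in>star x. W e \<omega> \<le> s n)"
    then obtain x where x: "x \<in> box n" "\<forall>e\<in>star x. W e \<omega> \<le> s n" by blast
    have "lambda1 n (env \<omega>) \<le> 2 * CARD('d) * s n"
      using x elim(2) n s by (intro lambda1_le_star[of _ x]) (auto intro: less_imp_le)
    then show "n \<ge> 1 \<and> lambda1 n (env \<omega>) \<le> 2 * CARD('d) * s n" using n by simp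
  qed
qed

end

section \<open>Decay of the comparison function and integral criteria\<close>

text \<open>In case (a) only the dilation factor 2 of the regular variation is needed.\<close>

lemma regular_decay:
  fixes g :: "real \<Rightarrow> real"
  assumes g_pos: "\<forall>u>0. g u > 0"
    and g_dec: "\<forall>u v. 0 < u \<longrightarrow> u \<le> v \<longrightarrow> g v \<le> g u"
    and g_cond: "(\<exists>\<rho> < -2. regularly_varying g \<rho>) \<or>
       ((mono_on {0<..} (\<lambda>u. u^2 * g u) \<or> antimono_on {0<..} (\<lambda>u. u^2 * g u)) \<and>
        (\<exists>L. ((\<lambda>u. u^2 * g u) \<longlongrightarrow> L) at_top))"
  obtains K u0 where "K \<ge> 1" "u0 \<ge> 1" "\<And>u v. u0 \<le> u \<Longrightarrow> u \<le> v \<Longrightarrow> v\<^sup>2 * g v \<le> K * (u\<^sup>2 * g u)"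
proof -
  consider (a) \<rho> where "\<rho> < -2" "regularly_varying g \<rho>"
    | (inc) L where "mono_on {0<..} (\<lambda>u. u^2 * g u)" "((\<lambda>u. u^2 * g u) \<longlongrightarrow> L) at_top"
    | (dec) "antimono_on {0<..} (\<lambda>u. u^2 * g u)"
    using g_cond by blast
  then show ?thesis
  proof cases
    case a
    have "((\<lambda>u. (g (2 * u) / (2 * u) powr \<rho>) / (g u / u powr \<rho>)) \<longlongrightarrow> 1) at_top"
      using a(2) by (simp add: regularly_varying_def)
    \<comment> \<open>The ratio tends to 1, hence eventually stays below this number; cancelling
      \<open>2 powr \<rho>\<close> yields \<open>g (2 * u) \<le> g u / 4\<close>.\<close>
    moreover have "(1::real) < 2 powr (-2 - \<rho>)" using a(1) by (intro gr_one_powr) auto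
    ultimately have "\<forall>\<^sub>F u in at_top. (g (2 * u) / (2 * u) powr \<rho>) / (g u / u powr \<rho>) < 2 powr (-2 - \<rho>)"
      by (rule order_tendstoD)
    then obtain u1 where u1: "\<And>u. u \<ge> u1 \<Longrightarrow> (g (2 * u) / (2 * u) powr \<rho>) / (g u / u powr \<rho>) < 2 powr (-2 - \<rho>)"
      unfolding eventually_at_top_linorder by blast
    define u0 where "u0 = max 1 u1"
    have half: "g (2 * u) \<le> g u / 4" if u: "u \<ge> u0" for u
    proof -
      have u': "u \<ge> 1" "u \<ge> u1" "g u > 0" using u g_pos by (auto simp: u0_def)
      have "(g (2 * u) / (2 * u) powr \<rho>) / (g u / u powr \<rho>) = g (2 * u) / (2 powr \<rho> * g u)"
        using u' by (simp add: powr_mult field_simps)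
      then have "g (2 * u) < 2 powr (-2 - \<rho>) * (2 powr \<rho> * g u)"
        using u1[OF u'(2)] u' by (simp add: divide_less_eq)
      also have "\<dots> = 2 powr (-2) * g u" by (simp add: powr_diff)
      finally show ?thesis by (simp add: powr_minus)
    qed
    have iter: "g (2 ^ k * u) \<le> g u / 4 ^ k" if u: "u \<ge> u0" for u and k :: nat
    proof (induction k)
      case (Suc k)
      have "u0 \<le> 2 ^ k * u"
      proof -
        have "1 * u \<le> 2 ^ k * u" using u by (intro mult_right_mono) (auto simp: u0_def)
        then show ?thesis using u by simp
      qed
      then have "g (2 * (2 ^ k * u)) \<le> g (2 ^ k * u) / 4" by (rule half)
      then show ?case using Suc by (simp add: mult.assoc)
    qed simp
    have "v\<^sup>2 * g v \<le> 4 * (u\<^sup>2 * g u)" if u: "u0 \<le> u" "u \<le> v" for u v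
    proof -
      have u0: "u > 0" using u by (simp add: u0_def)
      have "1 \<le> v / u" using u u0 by simp
      then have "1 \<le> nat \<lfloor>v / u\<rfloor>" by (simp add: le_nat_iff)
      \<comment> \<open>Each of the \<open>k\<close> complete doublings multiplies the square by 4
        and \<open>g\<close> by at most \<open>1/4\<close>; the last incomplete doubling costs the
        constant 4.\<close>
      then obtain k where k: "2 ^ k \<le> nat \<lfloor>v / u\<rfloor>" "nat \<lfloor>v / u\<rfloor> < 2 ^ (k + 1)"
        using ex_power_ivl1[of 2 "nat \<lfloor>v / u\<rfloor>"] by auto
      have "real (2 ^ k) \<le> real (nat \<lfloor>v / u\<rfloor>)" using k(1) by (simp only: of_nat_le_iff)
      also have "\<dots> \<le> v / u" using \<open>1 \<le> v / u\<close> by simp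
      finally have "2 ^ k \<le> v / u" by (simp only: of_nat_power of_nat_numeral)
      then have 1: "2 ^ k * u \<le> v" using u0 by (simp add: field_simps)
      have "real (nat \<lfloor>v / u\<rfloor> + 1) \<le> real (2 ^ (k + 1))" using k(2) by (simp only: of_nat_le_iff)
      then have "v / u < 2 ^ (k + 1)" using \<open>1 \<le> v / u\<close> unfolding of_nat_power of_nat_numeral
        by simp linarith
      then have 2: "v \<le> 2 ^ (k + 1) * u" using u0 by (simp add: field_simps)
      have "g v \<le> g (2 ^ k * u)" using g_dec 1 u0 by simp
      also have "\<dots> \<le> g u / 4 ^ k" using iter u(1) by blast
      finally have gv: "g v \<le> g u / 4 ^ k" .
      have "v\<^sup>2 \<le> (2 ^ (k + 1) * u)\<^sup>2" using 2 u u0 by (intro power_mono) auto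
      also have "\<dots> = 4 * 4 ^ k * u\<^sup>2"
      proof -
        have "(2 ^ k)\<^sup>2 = (4 :: real) ^ k" by (simp add: power2_eq_square power_mult_distrib[symmetric])
        then show ?thesis by (simp add: power_mult_distrib)
      qed
      finally have "v\<^sup>2 * g v \<le> (4 * 4 ^ k * u\<^sup>2) * (g u / 4 ^ k)"
      proof (intro mult_mono gv)
        have "g v > 0" using g_pos u u0 by simp
        then show "0 \<le> g v" by simp
      qed auto
      then show ?thesis by simp
    qed
    then show ?thesis by (intro that[of 4 u0]) (auto simp: u0_def)
  next
    case inc
    \<comment> \<open>An increasing function lies below its limit \<open>L\<close>, which is
      positive since \<open>g 1 > 0\<close>; being eventually above \<open>L / 2\<close>, it varies
      at most by the factor 2.\<close>
    have bound: "v\<^sup>2 * g v \<le> L" if v: "v > 0" for v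
    proof (rule tendsto_lowerbound[OF inc(2)])
      show "\<forall>\<^sub>F x in at_top. v\<^sup>2 * g v \<le> x\<^sup>2 * g x"
        using eventually_ge_at_top[of v] by eventually_elim (use inc(1) v in \<open>auto simp: mono_on_def\<close>)
    qed simp
    have "0 < g 1" using g_pos by simp
    then have "L > 0" using bound[of 1] by simp
    then have "\<forall>\<^sub>F u in at_top. L / 2 < u\<^sup>2 * g u" by (intro order_tendstoD[OF inc(2)]) simp
    then obtain u1 where u1: "\<And>u. u \<ge> u1 \<Longrightarrow> L / 2 < u\<^sup>2 * g u"
      unfolding eventually_at_top_linorder by blast
    show ?thesis
    proof (rule that[of 2 "max 1 u1"])
      fix u v :: real assume "max 1 u1 \<le> u" "u \<le> v"
      then show "v\<^sup>2 * g v \<le> 2 * (u\<^sup>2 * g u)" using u1[of u] bound[of v] by simp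
    qed auto
  next
    case dec
    show ?thesis
    proof (rule that[of 1 1])
      fix u v :: real assume "1 \<le> u" "u \<le> v"
      then show "v\<^sup>2 * g v \<le> 1 * (u\<^sup>2 * g u)" using dec by (auto simp: monotone_on_def)
    qed auto
  qed
qed

section \<open>Comparison of the integral with series\<close>

lemma unit_cell:
  fixes u :: real assumes "u > 1"
  obtains j :: nat where "u \<in> {real j + 1<..real j + 2}"
proof
  have "\<lceil>u\<rceil> \<ge> 2" using assms by linarith
  then show "u \<in> {real (nat (\<lceil>u\<rceil> - 2)) + 1<..real (nat (\<lceil>u\<rceil> - 2)) + 2}"
    by (simp add: of_nat_nat) linarith
qed

lemma disjoint_cells: "disjoint_family (\<lambda>j::nat. {real j + 1<..real j + 2})"
  unfolding disjoint_family_on_def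
proof (intro ballI impI)
  fix m n :: nat assume "m \<noteq> n"
  then have "m + 1 \<le> n \<or> n + 1 \<le> m" by linarith
  then have "real m + 1 \<le> real n \<or> real n + 1 \<le> real m" by linarith
  then show "{real m + 1<..real m + 2} \<inter> {real n + 1<..real n + 2} = {}" by auto
qed

lemma summable_div:
  fixes h :: "nat \<Rightarrow> real"
  assumes "summable h" "\<And>m. 0 \<le> h m" "D \<ge> 1"
  shows "summable (\<lambda>j. h (j div D))"
proof (rule summable_of_partial_sums_le[OF assms(1), where C = "real D" and h = "\<lambda>n. n"])
  fix n
  have "(\<Sum>k<n. h (k div D)) \<le> (\<Sum>k<n * D. h (k div D))"
    using assms by (intro sum_mono2) auto
  also have "\<dots> = (\<Sum>m<n. \<Sum>k\<in>{m * D..<m * D + D}. h (k div D))"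
    by (rule sum.nat_group[symmetric])
  also have "\<dots> = (\<Sum>m<n. real D * h m)"
  proof (rule sum.cong[OF refl])
    fix m
    have "(\<Sum>k\<in>{m * D..<m * D + D}. h (k div D)) = (\<Sum>k\<in>{m * D..<m * D + D}. h m)"
    proof (rule sum.cong[OF refl])
      fix k assume "k \<in> {m * D..<m * D + D}"
      then have "k div D = m" by (intro div_nat_eqI) (auto simp: algebra_simps)
      then show "h (k div D) = h m" by simp
    qed
    then show "(\<Sum>k\<in>{m * D..<m * D + D}. h (k div D)) = real D * h m" by simp
  qed
  finally show "(\<Sum>k<n. h (k div D)) \<le> real D * (\<Sum>k<n. h k)" by (simp add: sum_distrib_left)
qed (use assms in auto)

text \<open>For \<open>k \<ge> D\<close>, rounding down to the multiple \<open>D * (k div D)\<close>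
  only increases \<open>P\<close>, and each multiple is used \<open>D\<close> times. Monotonicity is
  assumed from 1 on, since \<open>P 0\<close> will involve \<open>g 0\<close>, about which nothing
  is known.\<close>

lemma summable_undilate:
  fixes P :: "nat \<Rightarrow> real"
  assumes P: "\<And>k. 0 \<le> P k" "\<And>k l. 1 \<le> k \<Longrightarrow> k \<le> l \<Longrightarrow> P l \<le> P k" and D: "D \<ge> 1"
    and sum: "summable (\<lambda>m. (real m + 1) ^ e * P (D * m))"
  shows "summable (\<lambda>k. (real k + 1) ^ e * P k)"
proof (rule summable_comparison_test'[where N = D])
  show "summable (\<lambda>k. real D ^ e * ((real (k div D) + 1) ^ e * P (D * (k div D))))"
    using sum P D by (intro summable_mult summable_div) auto
  fix k assume k: "k \<ge> D"
  have "1 \<le> k div D" using k D by (simp add: div_greater_zero_iff Suc_le_eq)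
  then have "1 \<le> D * (k div D)" using D by simp
  then have 1: "P k \<le> P (D * (k div D))" by (intro P) auto
  have "k < D * (k div D) + D" using D by (metis add.commute dividend_less_times_div le_simps(3) mult.commute One_nat_def)
  then have "k + 1 \<le> D * (k div D + 1)" by simp
  then have "real (k + 1) \<le> real (D * (k div D + 1))" by (simp only: of_nat_le_iff)
  then have "real k + 1 \<le> real D * (real (k div D) + 1)" by (simp add: algebra_simps)
  then have "(real k + 1) ^ e \<le> (real D * (real (k div D) + 1)) ^ e" by (intro power_mono) auto
  then have "(real k + 1) ^ e * P k \<le> (real D * (real (k div D) + 1)) ^ e * P (D * (k div D))"
    using 1 P by (intro mult_mono) auto
  then show "norm ((real k + 1) ^ e * P k) \<le> real D ^ e * ((real (k div D) + 1) ^ e * P (D * (k div D)))"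
    using P by (simp add: power_mult_distrib mult.assoc)
qed

context iid_conductances begin

lemma Lambda_div: "u > 0 \<Longrightarrow> Lambda CARD('d) mu g u / u = u ^ (CARD('d) - 1) * p (g u) ^ (2 * CARD('d))"
  using dim by (simp add: Lambda_def p_def power_eq_if)

text \<open>On the cell from \<open>j + 1\<close> to \<open>j + 2\<close> the integrand is at least
  the \<open>j\<close>-th term: the power is evaluated at the left end and the decreasing
  \<open>g\<close> at the right end. Disjointness of the cells turns the series into one
  integral.\<close>

lemma summable_of_integral_finite:
  assumes g_dec: "\<forall>u v. 0 < u \<longrightarrow> u \<le> v \<longrightarrow> g v \<le> g u"
    and fin: "(\<integral>\<^sup>+ u \<in> {0<..}. ennreal (Lambda CARD('d) mu g u / u) \<partial>lborel) < \<infinity>"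
  shows "summable (\<lambda>j. (real j + 1) ^ (CARD('d) - 1) * p (g (real j + 2)) ^ (2 * CARD('d)))"
proof -
  define a where "a j = (real j + 1) ^ (CARD('d) - 1) * p (g (real j + 2)) ^ (2 * CARD('d))" for j
  have a0: "a j \<ge> 0" for j by (simp add: a_def p_bounds)
  have "(\<Sum>j. ennreal (a j)) = (\<Sum>j. \<integral>\<^sup>+ u. ennreal (a j) * indicator {real j + 1<..real j + 2} u \<partial>lborel)"
    by (simp add: nn_integral_cmult_indicator)
  also have "\<dots> = (\<integral>\<^sup>+ u. (\<Sum>j. ennreal (a j) * indicator {real j + 1<..real j + 2} u) \<partial>lborel)"
    by (rule nn_integral_suminf[symmetric]) measurable
  also have "\<dots> \<le> (\<integral>\<^sup>+ u \<in> {0<..}. ennreal (Lambda CARD('d) mu g u / u) \<partial>lborel)"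
  proof (rule nn_integral_mono)
    fix u :: real
    show "(\<Sum>j. ennreal (a j) * indicator {real j + 1<..real j + 2} u)
      \<le> ennreal (Lambda CARD('d) mu g u / u) * indicator {0<..} u"
    proof (cases "u > 1")
      case True
      then obtain j where j: "u \<in> {real j + 1<..real j + 2}" by (rule unit_cell)
      have "(\<Sum>j. ennreal (a j) * indicator {real j + 1<..real j + 2} u) = ennreal (a j)"
        using suminf_cmult_indicator[OF disjoint_cells j, of "\<lambda>j. ennreal (a j)"] by simp
      also have "\<dots> \<le> ennreal (u ^ (CARD('d) - 1) * p (g u) ^ (2 * CARD('d)))"
        unfolding a_def using j g_dec p_bounds
        by (intro ennreal_leI mult_mono power_mono p_mono) auto
      also have "\<dots> = ennreal (Lambda CARD('d) mu g u / u) * indicator {0<..} u"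
        using True by (simp add: Lambda_div)
      finally show ?thesis .
    next
      case False
      then have "indicator {real j + 1<..real j + 2} u = (0 :: ennreal)" for j by (auto simp: indicator_def)
      then show ?thesis by simp
    qed
  qed
  also note fin
  finally have "summable a" using a0 by (intro summable_suminf_not_top) auto
  then show ?thesis by (simp add: a_def[abs_def])
qed

text \<open>The same cells with the ends exchanged; on the remaining interval from 0 to 1 the
  integrand is at most 1.\<close>

lemma integral_finite_of_summable:
  assumes g_dec: "\<forall>u v. 0 < u \<longrightarrow> u \<le> v \<longrightarrow> g v \<le> g u"
    and sum: "summable (\<lambda>j. (real j + 2) ^ (CARD('d) - 1) * p (g (real j + 1)) ^ (2 * CARD('d)))"
  shows "(\<integral>\<^sup>+ u \<in> {0<..}. ennreal (Lambda CARD('d) mu g u / u) \<partial>lborel) < \<infinity>"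
proof -
  define a where "a j = (real j + 2) ^ (CARD('d) - 1) * p (g (real j + 1)) ^ (2 * CARD('d))" for j
  have a0: "a j \<ge> 0" for j by (simp add: a_def p_bounds)
  have suma: "summable a" by (rule sum[folded a_def])
  have "(\<integral>\<^sup>+ u \<in> {0<..}. ennreal (Lambda CARD('d) mu g u / u) \<partial>lborel)
    \<le> (\<integral>\<^sup>+ u. indicator {0<..1} u + (\<Sum>j. ennreal (a j) * indicator {real j + 1<..real j + 2} u) \<partial>lborel)"
  proof (rule nn_integral_mono)
    fix u :: real
    show "ennreal (Lambda CARD('d) mu g u / u) * indicator {0<..} u
      \<le> indicator {0<..1} u + (\<Sum>j. ennreal (a j) * indicator {real j + 1<..real j + 2} u)"
    proof (cases "u > 1")
      case True
      then obtain j where j: "u \<in> {real j + 1<..real j + 2}" by (rule unit_cell)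
      have "ennreal (Lambda CARD('d) mu g u / u) * indicator {0<..} u
        = ennreal (u ^ (CARD('d) - 1) * p (g u) ^ (2 * CARD('d)))"
        using True by (simp add: Lambda_div)
      also have "\<dots> \<le> ennreal (a j)"
        unfolding a_def using j g_dec p_bounds
        by (intro ennreal_leI mult_mono power_mono p_mono) auto
      also have "\<dots> = (\<Sum>j. ennreal (a j) * indicator {real j + 1<..real j + 2} u)"
        using suminf_cmult_indicator[OF disjoint_cells j, of "\<lambda>j. ennreal (a j)"] by simp
      finally show ?thesis by (simp add: add_increasing)
    next
      case False
      show ?thesis
      proof (cases "u > 0")
        case True
        have "u ^ (CARD('d) - 1) * p (g u) ^ (2 * CARD('d)) \<le> 1 * 1"
          using True False p_bounds by (intro mult_mono power_le_one) auto
        then have "ennreal (Lambda CARD('d) mu g u / u) * indicator {0<..} u \<le> indicator {0<..1} u"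
          using True False by (simp add: Lambda_div)
        then show ?thesis by (simp add: add_increasing2)
      qed simp
    qed
  qed
  also have "\<dots> = (\<integral>\<^sup>+ u. indicator {0<..1::real} u \<partial>lborel)
    + (\<integral>\<^sup>+ u. (\<Sum>j. ennreal (a j) * indicator {real j + 1<..real j + 2} u) \<partial>lborel)"
    by (rule nn_integral_add) measurable
  also have "(\<integral>\<^sup>+ u. (\<Sum>j. ennreal (a j) * indicator {real j + 1<..real j + 2} u) \<partial>lborel)
    = (\<Sum>j. \<integral>\<^sup>+ u. ennreal (a j) * indicator {real j + 1<..real j + 2} u \<partial>lborel)"
    by (rule nn_integral_suminf) measurable
  also have "\<dots> = (\<Sum>j. ennreal (a j))" by (simp add: nn_integral_cmult_indicator)
  also have "\<dots> = ennreal (suminf a)" using a0 suma by (intro suminf_ennreal2) auto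
  also have "(\<integral>\<^sup>+ u. indicator {0<..1::real} u \<partial>lborel) + ennreal (suminf a) < \<infinity>" by simp
  finally show ?thesis .
qed

end

section \<open>Combination of the decay, the integral criteria and the almost sure bounds\<close>

theorem theorem1p3:
  fixes M :: "'w measure"
    and W :: "(int ^ 'd) set \<Rightarrow> 'w \<Rightarrow> real"
    and mu :: "real measure"
    and g :: "real \<Rightarrow> real"
  assumes dim: "CARD('d) \<ge> 2"
    and prob: "prob_space M"
    and indep: "prob_space.indep_vars M (\<lambda>_. borel) W edges"
    and law: "\<forall>e\<in>edges. distr M borel (W e) = mu"
    and pos: "\<forall>e\<in>edges. AE \<omega> in M. W e \<omega> > 0"
    and g_pos: "\<forall>u>0. g u > 0"
    and g_dec: "\<forall>u v. 0 < u \<longrightarrow> u \<le> v \<longrightarrow> g v \<le> g u"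
    and g_cond: "(\<exists>\<rho> < -2. regularly_varying g \<rho>) \<or>
       ((mono_on {0<..} (\<lambda>u. u^2 * g u) \<or> antimono_on {0<..} (\<lambda>u. u^2 * g u)) \<and>
        (\<exists>L. ((\<lambda>u. u^2 * g u) \<longlongrightarrow> L) at_top))"
  shows
   "((\<integral>\<^sup>+ u \<in> {0<..}. ennreal (Lambda CARD('d) mu g u / u) \<partial>lborel) < \<infinity> \<and>
       (\<exists>B. \<forall>u>0. Lambda CARD('d) mu g u \<le> B) \<longrightarrow>
      (\<exists>c>0. AE \<omega> in M. eventually (\<lambda>n. lambda1 n (\<lambda>e. W e \<omega>) \<ge> c * g (real n)) sequentially))
    \<and>
    ((\<integral>\<^sup>+ u \<in> {0<..}. ennreal (Lambda CARD('d) mu g u / u) \<partial>lborel) = \<infinity> \<longrightarrow>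
      (AE \<omega> in M. liminf (\<lambda>n. ereal (lambda1 n (\<lambda>e. W e \<omega>) / g (real n))) = 0))"
proof -
  interpret prob_space M by (fact prob)
  interpret iid_conductances M W mu
    by unfold_locales (use dim indep law pos in auto)
  let ?d = "CARD('d)"
  obtain K u0 where K: "K \<ge> 1" "u0 \<ge> 1" and decay: "\<And>u v. u0 \<le> u \<Longrightarrow> u \<le> v \<Longrightarrow> v\<^sup>2 * g v \<le> K * (u\<^sup>2 * g u)"
    using regular_decay[OF g_pos g_dec g_cond] by metis
  define m0 where "m0 = nat \<lceil>u0\<rceil>"
  have m0: "m0 \<ge> 1" "u0 \<le> real m0" using K(2) by (auto simp: m0_def le_nat_iff)
  show ?thesis
  proof (intro conjI impI)
    assume "(\<integral>\<^sup>+ u \<in> {0<..}. ennreal (Lambda ?d mu g u / u) \<partial>lborel) < \<infinity> \<and>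
       (\<exists>B. \<forall>u>0. Lambda ?d mu g u \<le> B)"
    then have sum: "summable (\<lambda>j. (real j + 1) ^ (?d - 1) * p (g (real j + 2)) ^ (2 * ?d))"
      by (intro summable_of_integral_finite g_dec) auto
    \<comment> \<open>Freezing \<open>g\<close> below \<open>m0\<close> makes the decay estimate,
      valid only from \<open>u0\<close> on, available at every index, and avoids
      \<open>g 0\<close>.\<close>
    define t where "t m = g (real (max m m0))" for m
    have t_anti: "antimono t" unfolding t_def antimono_def using g_dec m0(1) by (auto simp: max_def)
    have t_pos: "t m > 0" for m using g_pos m0(1) by (simp add: t_def max_def)
    have U: "(real n)\<^sup>2 * t n \<le> (K * (real m0)\<^sup>2) * (real r + 1)\<^sup>2 * t r" if "r \<le> n" for n r
    proof -
      \<comment> \<open>This bound produces the factor \<open>(real m0)\<^sup>2\<close> in the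
        constant.\<close>
      have r': "real (max r m0) \<le> real m0 * (real r + 1)"
      proof -
        have "r \<le> m0 * r" using m0(1) by (cases m0) auto
        then have "max r m0 \<le> m0 * (r + 1)" by (simp only: distrib_left mult_1_right max.bounded_iff) linarith
        then have "real (max r m0) \<le> real (m0 * (r + 1))" by (simp only: of_nat_le_iff)
        then show ?thesis by (simp add: algebra_simps)
      qed
      have "(real n)\<^sup>2 * t n \<le> (real (max n m0))\<^sup>2 * t n"
        using t_pos[of n] by (intro mult_right_mono power_mono) auto
      also have "\<dots> \<le> K * ((real (max r m0))\<^sup>2 * t r)"
        unfolding t_def using that m0 by (intro decay) (auto simp: max_def)
      also have "\<dots> \<le> K * ((real m0 * (real r + 1))\<^sup>2 * t r)"
        using K(1) t_pos[of r] r' by (intro mult_left_mono mult_right_mono power_mono) auto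
      finally show ?thesis by (simp add: power_mult_distrib mult_ac)
    qed
    have sum_t: "summable (\<lambda>m. (real m + 1) ^ (?d - 1) * p (t m) ^ (2 * ?d))"
    proof -
      \<comment> \<open>The shift by 2 aligns \<open>t\<close> with the right ends of the cells, and
        \<open>j + 3 \<le> 3 * (j + 1)\<close> gives the factor 3.\<close>
      have "summable (\<lambda>j. (real (j + 2) + 1) ^ (?d - 1) * p (t (j + 2)) ^ (2 * ?d))"
      proof (rule summable_comparison_test'[OF summable_mult[OF sum, of "3 ^ (?d - 1)"], of m0])
        fix j assume j: "m0 \<le> j"
        have tj: "t (j + 2) = g (real j + 2)" using j by (simp add: t_def max_def add.commute)
        have "(real (j + 2) + 1) ^ (?d - 1) * p (t (j + 2)) ^ (2 * ?d)
          \<le> (3 * (real j + 1)) ^ (?d - 1) * p (g (real j + 2)) ^ (2 * ?d)"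
          unfolding tj using p_bounds by (intro mult_right_mono power_mono) auto
        also have "\<dots> = 3 ^ (?d - 1) * ((real j + 1) ^ (?d - 1) * p (g (real j + 2)) ^ (2 * ?d))"
          by (simp only: power_mult_distrib mult.assoc)
        finally show "norm ((real (j + 2) + 1) ^ (?d - 1) * p (t (j + 2)) ^ (2 * ?d))
          \<le> 3 ^ (?d - 1) * ((real j + 1) ^ (?d - 1) * p (g (real j + 2)) ^ (2 * ?d))"
          using p_bounds by simp
      qed
      then show ?thesis by (subst (asm) summable_iff_shift)
    qed
    have "K * (real m0)\<^sup>2 > 0" using K(1) m0(1) by simp
    from lambda1_lower_bound[OF t_anti t_pos this U sum_t]
    obtain c where c: "c > 0" "AE \<omega> in M. \<forall>\<^sub>F n in sequentially. c * t n \<le> lambda1 n (\<lambda>e. W e \<omega>)" by blast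
    have "AE \<omega> in M. \<forall>\<^sub>F n in sequentially. c * g (real n) \<le> lambda1 n (\<lambda>e. W e \<omega>)"
      using c(2)
    proof eventually_elim
      case (elim \<omega>)
      then show ?case using eventually_ge_at_top[of m0] by eventually_elim (simp add: t_def max_def)
    qed
    then show "\<exists>c>0. AE \<omega> in M. \<forall>\<^sub>F n in sequentially. c * g (real n) \<le> lambda1 n (\<lambda>e. W e \<omega>)"
      using c(1) by blast
  next
    assume inf: "(\<integral>\<^sup>+ u \<in> {0<..}. ennreal (Lambda ?d mu g u / u) \<partial>lborel) = \<infinity>"
    have "AE \<omega> in M. \<exists>\<^sub>F n in sequentially. n \<ge> 1 \<and> lambda1 n (\<lambda>e. W e \<omega>) \<le> 2 * ?d * (\<epsilon> * g (real n))"
      if \<epsilon>: "\<epsilon> > 0" for \<epsilon>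
    proof (rule lambda1_upper_bound)
      show "0 \<le> \<epsilon> * g (real n)" if "n \<ge> 1" for n
        using \<epsilon> g_pos that by (intro mult_nonneg_nonneg) (auto intro: less_imp_le)
      show "\<not> summable (\<lambda>m. (real m + 1) ^ (?d - 1) * p (\<epsilon> * g (real (2 * m))) ^ (2 * ?d))"
      proof
        assume sum: "summable (\<lambda>m. (real m + 1) ^ (?d - 1) * p (\<epsilon> * g (real (2 * m))) ^ (2 * ?d))"
        \<comment> \<open>Dilation by \<open>C\<close> gains the factor \<open>\<epsilon>\<close>:
          the decay gives \<open>C\<^sup>2 * g (C * u) \<le> K * g u\<close>, and
          \<open>K \<le> \<epsilon> * C \<le> \<epsilon> * C\<^sup>2\<close>.\<close>
        obtain C :: nat where C: "K / \<epsilon> \<le> real C" using real_arch_simple by blast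
        have C1: "C \<ge> 1" using C K(1) \<epsilon> by (cases C) (auto simp: field_simps)
        have small: "g (real C * u) \<le> \<epsilon> * g u" if u: "u \<ge> u0" for u
        proof -
          have u0: "u > 0" "g u > 0" using u K(2) g_pos by auto
          have "(real C * u)\<^sup>2 * g (real C * u) \<le> K * (u\<^sup>2 * g u)"
            using C1 u0 by (intro decay u) auto
          then have "(real C)\<^sup>2 * g (real C * u) \<le> K * g u"
            using u0 by (simp add: power_mult_distrib mult.left_commute[of K] mult.commute[of "(real C)\<^sup>2"] mult.assoc)
          also have "\<dots> \<le> (\<epsilon> * real C) * g u" using C \<epsilon> u0 by (intro mult_right_mono) (auto simp: field_simps)
          also have "\<dots> \<le> (\<epsilon> * (real C)\<^sup>2) * g u"
            using C1 \<epsilon> u0 by (intro mult_right_mono mult_left_mono) (auto simp: power2_eq_square)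
          finally have "(real C)\<^sup>2 * g (real C * u) \<le> (real C)\<^sup>2 * (\<epsilon> * g u)" by (simp add: mult_ac)
          then show ?thesis using C1 by simp
        qed
        define P where "P k = p (g (real k)) ^ (2 * ?d)" for k
        \<comment> \<open>The dilation \<open>2 * C\<close> combines the 2 from the even sublattice
          with the \<open>C\<close> that absorbs \<open>\<epsilon>\<close>;
          \<open>summable_undilate\<close> removes it.\<close>
        have "summable (\<lambda>m. (real m + 1) ^ (?d - 1) * P (2 * C * m))"
        proof (rule summable_comparison_test'[OF sum, of m0])
          fix m assume m: "m0 \<le> m"
          have "g (real (2 * C * m)) \<le> \<epsilon> * g (real (2 * m))"
            using small[of "real (2 * m)"] m m0 by (simp add: mult_ac)
          then have "P (2 * C * m) \<le> p (\<epsilon> * g (real (2 * m))) ^ (2 * ?d)"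
            unfolding P_def by (intro power_mono p_mono p_bounds)
          then show "norm ((real m + 1) ^ (?d - 1) * P (2 * C * m))
            \<le> (real m + 1) ^ (?d - 1) * p (\<epsilon> * g (real (2 * m))) ^ (2 * ?d)"
            by (simp add: P_def p_bounds mult_left_mono)
        qed
        then have "summable (\<lambda>k. (real k + 1) ^ (?d - 1) * P k)"
        proof (rule summable_undilate[rotated 3])
          show "P l \<le> P k" if "1 \<le> k" "k \<le> l" for k l
            unfolding P_def using that g_dec by (intro power_mono p_mono p_bounds) auto
        qed (use C1 in \<open>auto simp: P_def p_bounds\<close>)
        then have "summable (\<lambda>j. (real (Suc j) + 1) ^ (?d - 1) * P (Suc j))"
          by (subst summable_Suc_iff)
        then have "summable (\<lambda>j. (real j + 2) ^ (?d - 1) * p (g (real j + 1)) ^ (2 * ?d))"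
          by (simp add: P_def add.commute)
        from integral_finite_of_summable[OF g_dec this] inf show False by simp
      qed
    qed
    \<comment> \<open>Countably many values of \<open>\<epsilon>\<close> tending to 0 share one null
      set.\<close>
    then have "AE \<omega> in M. \<forall>j. \<exists>\<^sub>F n in sequentially. n \<ge> 1 \<and>
      lambda1 n (\<lambda>e. W e \<omega>) \<le> 2 * ?d * (inverse (real (Suc j)) * g (real n))"
      by (subst AE_all_countable) auto
    then show "AE \<omega> in M. liminf (\<lambda>n. ereal (lambda1 n (\<lambda>e. W e \<omega>) / g (real n))) = 0"
      using AE_pos
    proof eventually_elim
      case (elim \<omega>)
      let ?q = "\<lambda>n. lambda1 n (\<lambda>e. W e \<omega>) / g (real n)"
      show ?case
      proof (rule antisym)
        show "0 \<le> liminf (\<lambda>n. ereal (?q n))"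
        proof (rule Liminf_bounded)
          show "\<forall>\<^sub>F n in sequentially. 0 \<le> ereal (?q n)"
            using eventually_ge_at_top[of 1]
          proof eventually_elim
            case (elim n)
            have "0 \<le> lambda1 n (\<lambda>e. W e \<omega>)"
              using \<open>\<forall>e\<in>edges. 0 < W e \<omega>\<close> by (intro lambda1_nonneg) (auto intro: less_imp_le)
            moreover have "g (real n) > 0" using elim g_pos by simp
            ultimately show ?case by simp
          qed
        qed
        show "liminf (\<lambda>n. ereal (?q n)) \<le> 0"
        proof (rule ccontr)
          assume "\<not> liminf (\<lambda>n. ereal (?q n)) \<le> 0"
          then have "ereal 0 < liminf (\<lambda>n. ereal (?q n))" by (simp add: zero_ereal_def)
          then obtain \<delta> where \<delta>: "ereal 0 < ereal \<delta>" "ereal \<delta> < liminf (\<lambda>n. ereal (?q n))"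
            using ereal_dense2 by blast
          have ev: "\<forall>\<^sub>F n in sequentially. ereal \<delta> < ereal (?q n)" using \<delta>(2) by (rule less_LiminfD)
          have "\<delta> / (2 * ?d) > 0" using \<delta>(1) dim by simp
          then obtain j where j: "inverse (real (Suc j)) < \<delta> / (2 * ?d)" using reals_Archimedean by blast
          from elim(1) have "\<exists>\<^sub>F n in sequentially. n \<ge> 1 \<and>
            lambda1 n (\<lambda>e. W e \<omega>) \<le> 2 * ?d * (inverse (real (Suc j)) * g (real n))" by blast
          from frequently_eventually_conj[OF this ev]
          obtain n where n: "n \<ge> 1" "lambda1 n (\<lambda>e. W e \<omega>) \<le> 2 * ?d * (inverse (real (Suc j)) * g (real n))" "\<delta> < ?q n"
            by (auto dest: frequently_ex)
          have gn: "g (real n) > 0" using n(1) g_pos by simp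
          have "?q n \<le> 2 * ?d * inverse (real (Suc j))" using n(2) gn by (simp add: divide_le_eq mult_ac)
          also have "\<dots> < \<delta>" using j dim by (simp add: field_simps)
          finally show False using n(3) by simp
        qed
      qed
    qed
  qed
qed

end
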